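(* Let $d,n,m\in\mathbb{N}$, let $\alpha=(\alpha_j)_{j\in\mathbb{I}_m}\in(\mathbb{R}_{\ge 0}^m)^\downarrow$ (that is, $\alpha$ has non-negative entries arranged in non-increasing order), let $N(\cdot)$ be a strictly convex unitarily invariant norm in $\mathcal{M}_d(\mathbb{C})$, and consider the set $\Lambda_\alpha$. Let $A\in\mathcal{M}_d(\mathbb{C})^+$ be positive semidefinite. Then there exists $\mathcal{F}^{\rm op}=\{T_j^{\rm op}\}_{j\in\mathbb{I}_m}\in\Lambda_\alpha$ such that $$N(A-S_{\mathcal{F}^{\rm op}})\le N(A-S_{\mathcal{F}})\quad\text{for all }\mathcal{F}\in\Lambda_\alpha.$$ Moreover, the minimal distance (and the approximants) can be computed using the spectrum of $A$ and the weights $\big(\frac{\alpha_1}{n}\mathbf{1}_n,\frac{\alpha_2}{n}\mathbf{1}_n,\dots,\frac{\alpha_m}{n}\mathbf{1}_n\big)$ as the initial data for the classical approximation problem. Even more, the best approximants do not depend on the choice of the strictly convex unitarily invariant norm.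
   Context: $\mathbb{I}_m=\{1,\dots,m\}$; $\mathbf{1}_n\in\mathbb{R}^n$ is the all-ones vector; $\mathcal{M}_d(\mathbb{C})$ is the algebra of $d\times d$ complex matrices and $\mathcal{M}_d(\mathbb{C})^+$ its cone of positive semidefinite matrices; $\|T\|_2^2=\operatorname{tr}(T^*T)$ (squared Frobenius norm). A norm $N$ in $\mathcal{M}_d(\mathbb{C})$ is unitarily invariant if $N(UBV)=N(B)$ for every $B\in\mathcal{M}_d(\mathbb{C})$ and all unitary $U,V\in\mathcal{M}_d(\mathbb{C})$; it is strictly convex if its restriction to diagonal matrices is a strictly convex norm in $\mathbb{C}^d$. A G-Bessel sequence for $\mathbb{C}^d$ with analysis space $\mathbb{C}^n$ is a family $\mathcal{F}=\{T_i\}_{i\in\mathbb{I}_m}$ of bounded linear operators $T_i:\mathbb{C}^d\to\mathbb{C}^n$ for which there is $b>0$ with $\sum_{i\in\mathbb{I}_m}\|T_ix\|^2\le b\|x\|^2$ for all $x\in\mathbb{C}^d$. Its frame operator is $S_{\mathcal{F}}=\sum_{i\in\mathbb{I}_m}T_i^*T_i$. The set $\Lambda_\alpha$ consists of all G-Bessel sequences $\mathcal{F}=\{T_i\}_{i\in\mathbb{I}_m}$ for $\mathbb{C}^d$, with analysis space $\mathbb{C}^n$, such that $\|T_i\|_2^2=\alpha_i$ for $i\in\mathbb{I}_m$. The classical approximation problem, for a positive semidefinite $A\in\mathcal{M}_d(\mathbb{C})$ and a finite sequence of weights $w=(w_i)_{i\in\mathbb{I}_K}$, is to minimize $N(A-S_{\mathcal{G}})$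 over the finite sequences of vectors $\mathcal{G}=\{g_i\}_{i\in\mathbb{I}_K}$ in $\mathbb{C}^d$ with $\|g_i\|^2=w_i$ for $i\in\mathbb{I}_K$, where $S_{\mathcal{G}}=\sum_{i\in\mathbb{I}_K}g_i\otimes g_i$ and $(g\otimes g)z=\langle z,g\rangle g$. *)

theory Defs
  imports "HOL-Analysis.Analysis"
begin

section \<open>Complex matrices\<close>

text \<open>Linear operators from \<open>\<complex>\<^sup>d\<close> to \<open>\<complex>\<^sup>n\<close> are identified with their matrices
  \<open>complex^'d^'n\<close>, acting by \<open>*v\<close>; the dimensions are \<open>d = CARD('d)\<close> and \<open>n = CARD('n)\<close>.
  The type-class norm of \<open>complex^'n\<close> is the Euclidean norm.\<close>

definition adj :: "complex^'d^'n \<Rightarrow> complex^'n^'d" where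
  "adj T = map_matrix cnj (transpose T)"

definition cinner :: "complex^'n \<Rightarrow> complex^'n \<Rightarrow> complex" where
  "cinner x y = (\<Sum>i\<in>UNIV. x $ i * cnj (y $ i))"

text \<open>The rank-one operator \<open>g \<otimes> g\<close>; see \<open>rank_one_mult\<close> for its action.\<close>

definition rank_one :: "complex^'n \<Rightarrow> complex^'n^'n" where
  "rank_one g = (\<chi> i j. g $ i * cnj (g $ j))"

lemma rank_one_mult: "rank_one g *v z = cinner z g *s g"
  by (simp add: rank_one_def cinner_def matrix_vector_mult_def vec_eq_iff sum_distrib_right sum_distrib_left
      mult_ac)

lemma cinner_adj: "cinner (T *v x) y = cinner x (adj T *v y)"
proof -
  have "cinner (T *v x) y = (\<Sum>i\<in>UNIV. \<Sum>j\<in>UNIV. T $ i $ j * x $ j * cnj (y $ i))"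
    by (simp add: cinner_def matrix_vector_mult_def sum_distrib_right)
  also have "\<dots> = (\<Sum>j\<in>UNIV. \<Sum>i\<in>UNIV. T $ i $ j * x $ j * cnj (y $ i))"
    by (rule sum.swap)
  also have "\<dots> = cinner x (adj T *v y)"
    by (simp add: cinner_def matrix_vector_mult_def adj_def transpose_def sum_distrib_left mult_ac)
  finally show ?thesis .
qed

definition psd :: "complex^'d^'d \<Rightarrow> bool" where
  "psd A \<longleftrightarrow> adj A = A \<and> (\<forall>x. 0 \<le> Re (cinner (A *v x) x))"

definition unitary :: "complex^'d^'d \<Rightarrow> bool" where
  "unitary U \<longleftrightarrow> adj U ** U = mat 1 \<and> U ** adj U = mat 1"

definition diag :: "complex^'d \<Rightarrow> complex^'d^'d" where
  "diag x = (\<chi> i j. if i = j then x $ i else 0)"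

definition frobenius_sq :: "complex^'d^'n \<Rightarrow> real" where
  "frobenius_sq T = Re (trace (adj T ** T))"

text \<open>\<open>l\<close> lists the spectrum of \<open>A\<close>, each eigenvalue being repeated according to its
  multiplicity as a root of the characteristic polynomial. Being indexed by \<open>'d\<close>, the list
  carries no preferred order.\<close>

definition spectrum_list :: "complex^'d^'d \<Rightarrow> real^'d \<Rightarrow> bool" where
  "spectrum_list A l \<longleftrightarrow> (\<forall>z. det (mat z - A) = (\<Prod>i\<in>UNIV. z - complex_of_real (l $ i)))"

definition diag_real :: "real^'d \<Rightarrow> complex^'d^'d" where
  "diag_real l = diag (\<chi> i. complex_of_real (l $ i))"

section \<open>Norms\<close>

text \<open>Norms on the complex vector spaces \<open>\<complex>\<^sup>d\<close> and \<open>\<M>\<^sub>d(\<complex>)\<close>. Non-negativity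
  follows from the three axioms.\<close>

definition vec_norm :: "(complex^'d \<Rightarrow> real) \<Rightarrow> bool" where
  "vec_norm p \<longleftrightarrow>
     (\<forall>x. p x = 0 \<longleftrightarrow> x = 0) \<and>
     (\<forall>c x. p (c *s x) = cmod c * p x) \<and>
     (\<forall>x y. p (x + y) \<le> p x + p y)"

definition mat_norm :: "(complex^'d^'d \<Rightarrow> real) \<Rightarrow> bool" where
  "mat_norm N \<longleftrightarrow>
     (\<forall>B. N B = 0 \<longleftrightarrow> B = 0) \<and>
     (\<forall>c B. N (map_matrix ((*) c) B) = cmod c * N B) \<and>
     (\<forall>B C. N (B + C) \<le> N B + N C)"

definition unitarily_invariant_norm :: "(complex^'d^'d \<Rightarrow> real) \<Rightarrow> bool" where
  "unitarily_invariant_norm N \<longleftrightarrow>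
     mat_norm N \<and> (\<forall>U V B. unitary U \<longrightarrow> unitary V \<longrightarrow> N (U ** B ** V) = N B)"

definition strictly_convex_vec_norm :: "(complex^'d \<Rightarrow> real) \<Rightarrow> bool" where
  "strictly_convex_vec_norm p \<longleftrightarrow>
     vec_norm p \<and>
     (\<forall>x y. \<forall>t::real. p x = 1 \<longrightarrow> p y = 1 \<longrightarrow> x \<noteq> y \<longrightarrow> 0 < t \<longrightarrow> t < 1 \<longrightarrow>
        p (t *\<^sub>R x + (1 - t) *\<^sub>R y) < 1)"

definition strictly_convex_ui_norm :: "(complex^'d^'d \<Rightarrow> real) \<Rightarrow> bool" where
  "strictly_convex_ui_norm N \<longleftrightarrow>
     unitarily_invariant_norm N \<and> strictly_convex_vec_norm (\<lambda>x. N (diag x))"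

section \<open>G-Bessel sequences\<close>

text \<open>Families indexed by \<open>{1..m}\<close> are total functions on \<open>nat\<close>; their values outside
  \<open>{1..m}\<close> are never used.\<close>

definition g_bessel :: "nat \<Rightarrow> (nat \<Rightarrow> complex^'d^'n) \<Rightarrow> bool" where
  "g_bessel m F \<longleftrightarrow>
     (\<exists>b>0. \<forall>x. (\<Sum>i\<in>{1..m}. (norm (F i *v x))\<^sup>2) \<le> b * (norm x)\<^sup>2)"

definition g_frame_op :: "nat \<Rightarrow> (nat \<Rightarrow> complex^'d^'n) \<Rightarrow> complex^'d^'d" where
  "g_frame_op m F = (\<Sum>i\<in>{1..m}. adj (F i) ** F i)"

definition Lambda_set :: "nat \<Rightarrow> (nat \<Rightarrow> real) \<Rightarrow> (nat \<Rightarrow> complex^'d^'n) set" where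
  "Lambda_set m \<alpha> = {F. g_bessel m F \<and> (\<forall>i\<in>{1..m}. frobenius_sq (F i) = \<alpha> i)}"

section \<open>The classical approximation problem\<close>

definition vec_families :: "nat \<Rightarrow> (nat \<Rightarrow> real) \<Rightarrow> (nat \<Rightarrow> complex^'d) set" where
  "vec_families K w = {G. \<forall>i\<in>{1..K}. (norm (G i))\<^sup>2 = w i}"

definition frame_op :: "nat \<Rightarrow> (nat \<Rightarrow> complex^'d) \<Rightarrow> complex^'d^'d" where
  "frame_op K G = (\<Sum>i\<in>{1..K}. rank_one (G i))"

text \<open>The \<open>k\<close>-th entry, \<open>1 \<le> k \<le> m n\<close>, of
  \<open>(\<alpha>\<^sub>1/n, \<dots>, \<alpha>\<^sub>1/n, \<dots>, \<alpha>\<^sub>m/n, \<dots>, \<alpha>\<^sub>m/n)\<close>, each value occurring \<open>n\<close> times.\<close>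

definition split_weights :: "nat \<Rightarrow> (nat \<Rightarrow> real) \<Rightarrow> nat \<Rightarrow> real" where
  "split_weights n \<alpha> k = \<alpha> ((k - 1) div n + 1) / real n"

section \<open>Best approximants\<close>

definition best_g :: "(complex^'d^'d \<Rightarrow> real) \<Rightarrow> complex^'d^'d \<Rightarrow> nat \<Rightarrow> (nat \<Rightarrow> real) \<Rightarrow>
    (nat \<Rightarrow> complex^'d^'n) set" where
  "best_g N A m \<alpha> = {F \<in> Lambda_set m \<alpha>.
     \<forall>F' \<in> (Lambda_set m \<alpha> :: (nat \<Rightarrow> complex^'d^'n) set).
       N (A - g_frame_op m F) \<le> N (A - g_frame_op m F')}"

definition best_classical :: "(complex^'d^'d \<Rightarrow> real) \<Rightarrow> complex^'d^'d \<Rightarrow> nat \<Rightarrow>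
    (nat \<Rightarrow> real) \<Rightarrow> (nat \<Rightarrow> complex^'d) set" where
  "best_classical N A K w = {G \<in> vec_families K w.
     \<forall>G' \<in> vec_families K w. N (A - frame_op K G) \<le> N (A - frame_op K G')}"

end

theory Submission
  imports Defs
begin

text \<open>Rotating the rows of \<open>T\<close> shows that \<open>T\<^sup>*T\<close> is a sum of \<open>n\<close> rank-one operators of equal
  trace, so the frame operators of \<open>\<Lambda>\<^sub>\<alpha>\<close> are exactly those of the classical problem with the
  split weights \<open>w\<close>. For the classical problem let \<open>a\<close> be the decreasing spectrum of \<open>A\<close>.
  Courant--Fischer test vectors give, for every frame operator \<open>S\<close>, every \<open>k\<close> and every \<open>t\<close>,
  \<open>tr (A - S - t)\<^sup>+ \<ge> (\<Sum>i>k. (a\<^sub>i - t)\<^sup>+) - (\<Sum>i>k. w\<^sub>i)\<close>.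
  The least squares approximation \<open>r\<close> of \<open>a\<close> among the non-negative vectors whose partial sums
  dominate those of \<open>w\<close> attains, for each \<open>t\<close>, one of these bounds or is trivially optimal, and by
  Horn's theorem some frame operator has the eigenvectors of \<open>A\<close> with eigenvalues \<open>r\<close>. Hence the
  spectrum of the corresponding difference is majorised by the spectrum of every \<open>A - S\<close>. A
  strictly convex unitarily invariant norm is strictly increasing for majorisation, so its
  minimisers are the \<open>S\<close> for which \<open>A - S\<close> has this least spectrum, whatever the norm.\<close>

section \<open>Hermitian matrices\<close>

text \<open>The norm is arbitrary in its class, so one difference must win for every threshold
  \<open>t\<close> at once, although the active bound \<open>k\<close> moves with \<open>t\<close>.
  Minimising a single sum of squares produces it: at the optimum, mass of \<open>r\<close> can be
  blocked only by a zero entry of \<open>r\<close> or by a tight partial sum, and these are the two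
  effects that the lower bounds record. In such a bound the test vectors are orthogonal to the first
  \<open>k\<close> vectors of the family, and the remaining ones cost at most their total weight.
  The entries of \<open>r\<close> follow the order of the eigenvalues of \<open>A\<close>, and the
  differences \<open>a i - r i\<close> may be unsorted; hence majorisation is expressed by positive
  parts, which are blind to order. Transfers of mass between two entries occur in two guises. On
  squared norms they are plane rotations of two vectors, which leave the frame operator unchanged.
  On eigenvalues they are proper convex combinations with a transposed vector, which lower a
  strictly convex norm. One chain lemma with an abstract invariant \<open>Q\<close> serves
  both.\<close>

lemma cinner_add_left: "cinner (x + y) z = cinner x z + cinner y z"
  by (simp add: cinner_def algebra_simps sum.distrib)

lemma cinner_add_right: "cinner z (x + y) = cinner z x + cinner z y"
  by (simp add: cinner_def algebra_simps sum.distrib)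

lemma cinner_diff_left: "cinner (x - y) z = cinner x z - cinner y z"
  by (simp add: cinner_def algebra_simps sum_subtractf)

lemma cinner_diff_right: "cinner z (x - y) = cinner z x - cinner z y"
  by (simp add: cinner_def algebra_simps sum_subtractf)

lemma cinner_scale_left: "cinner (c *s x) z = c * cinner x z"
  by (simp add: cinner_def sum_distrib_left mult_ac)

lemma cinner_scale_right: "cinner z (c *s x) = cnj c * cinner z x"
  by (simp add: cinner_def sum_distrib_left mult_ac)

lemma cinner_zero_left [simp]: "cinner 0 x = 0"
  by (simp add: cinner_def)

lemma cinner_zero_right [simp]: "cinner x 0 = 0"
  by (simp add: cinner_def)

lemma cinner_sum_left: "cinner (\<Sum>i\<in>I. f i) z = (\<Sum>i\<in>I. cinner (f i) z)"
  by (induction I rule: infinite_finite_induct) (auto simp: cinner_add_left)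

lemma cinner_sum_right: "cinner z (\<Sum>i\<in>I. f i) = (\<Sum>i\<in>I. cinner z (f i))"
  by (induction I rule: infinite_finite_induct) (auto simp: cinner_add_right)

lemmas cinner_linear = cinner_add_left cinner_add_right cinner_diff_left cinner_diff_right
  cinner_scale_left cinner_scale_right cinner_sum_left cinner_sum_right

lemma cnj_cinner: "cnj (cinner x y) = cinner y x"
  by (simp add: cinner_def mult_ac)

lemma cinner_self: "cinner x x = complex_of_real ((norm x)\<^sup>2)"
  by (simp add: cinner_def norm_vec_def L2_set_def sum_nonneg complex_norm_square
      del: of_real_power)

lemma cinner_eq_zero_commute: "cinner x y = 0 \<longleftrightarrow> cinner y x = 0"
  by (metis cnj_cinner complex_cnj_zero_iff)

lemma cmod_cinner_commute: "cmod (cinner x y) = cmod (cinner y x)"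
  by (metis cnj_cinner complex_mod_cnj)

lemma Re_cinner: "Re (cinner x y) = inner x y"
  by (simp add: cinner_def inner_vec_def inner_complex_def)

lemma cinner_hermitian:
  assumes "adj A = A"
  shows "cinner (A *v x) y = cinner x (A *v y)"
  using cinner_adj[of A x y] assms by simp

lemma matrix_vector_mult_scale: "(A::complex^'d^'n) *v (c *s x) = c *s (A *v x)"
  by (simp add: matrix_vector_mult_def vec_eq_iff sum_distrib_left mult_ac)

lemma matrix_vector_mult_sum: "(A::complex^'d^'n) *v (\<Sum>i\<in>I. f i) = (\<Sum>i\<in>I. A *v f i)"
  by (induction I rule: infinite_finite_induct) (auto simp: matrix_vector_right_distrib)

lemma matrix_vector_mult_sum_left: "(\<Sum>i\<in>I. (F i :: complex^'d^'n)) *v x = (\<Sum>i\<in>I. F i *v x)"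
  by (induction I rule: infinite_finite_induct) (auto simp: matrix_vector_mult_add_rdistrib)

lemma adj_diff: "adj (A - B) = adj A - adj B"
  by (simp add: adj_def vec_eq_iff map_matrix_def transpose_def)

lemma adj_sum: "adj (\<Sum>i\<in>I. F i) = (\<Sum>i\<in>I. adj (F i))"
  by (induction I rule: infinite_finite_induct)
     (auto simp: adj_def vec_eq_iff map_matrix_def transpose_def)

lemma adj_rank_one: "adj (rank_one g) = rank_one g"
  by (simp add: adj_def vec_eq_iff map_matrix_def transpose_def rank_one_def)

lemma adj_adj [simp]: "adj (adj A) = A"
  by (simp add: adj_def vec_eq_iff map_matrix_def transpose_def)

lemma adj_frame_op: "adj (frame_op K G) = frame_op K G"
  by (simp add: frame_op_def adj_sum adj_rank_one)

lemma cinner_rank_one: "cinner (rank_one g *v x) x = complex_of_real ((cmod (cinner x g))\<^sup>2)"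
  by (simp add: rank_one_mult cinner_linear complex_norm_square cnj_cinner del: of_real_power)

lemma cinner_frame_op:
  "cinner (frame_op K G *v x) x = complex_of_real (\<Sum>i\<in>{1..K}. (cmod (cinner x (G i)))\<^sup>2)"
  by (simp add: frame_op_def matrix_vector_mult_sum_left cinner_sum_left cinner_rank_one)

lemma norm_scale_of_real: "norm (complex_of_real r *s x) = \<bar>r\<bar> * norm (x::complex^'d)"
  by (simp add: norm_vec_def L2_set_def norm_mult power_mult_distrib
          sum_distrib_left[symmetric] real_sqrt_mult)

section \<open>Linear systems and orthonormal systems\<close>

text \<open>Gaussian elimination with more unknowns than equations. The dimension arguments below
  rest on it: completeness of orthonormal systems, unit vectors orthogonal to given ones, and the
  test vectors of the lower bound.\<close>

lemma nontrivial_solution: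
  fixes M :: "'i \<Rightarrow> 'z \<Rightarrow> 'f::field"
  assumes "finite Z" "finite I" "card Z < card I"
  shows "\<exists>c. (\<exists>i\<in>I. c i \<noteq> 0) \<and> (\<forall>z\<in>Z. (\<Sum>i\<in>I. c i * M i z) = 0)"
  using assms
proof (induction Z arbitrary: I M rule: finite_induct)
  case empty
  then obtain i where "i \<in> I" by (metis card.empty ex_in_conv less_irrefl)
  then show ?case by (intro exI[of _ "\<lambda>_. 1"]) auto
next
  case (insert z Z)
  show ?case
  proof (cases "\<forall>i\<in>I. M i z = 0")
    case True
    obtain c where "\<exists>i\<in>I. c i \<noteq> 0" "\<forall>z\<in>Z. (\<Sum>i\<in>I. c i * M i z) = 0"
      using insert.IH[of I M] insert.prems insert.hyps by auto
    then show ?thesis using True by (intro exI[of _ c]) auto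
  next
    case False
    then obtain p where p: "p \<in> I" "M p z \<noteq> 0" by blast
    \<comment> \<open>Equation \<open>z\<close> eliminates the unknown \<open>p\<close>; the value
      that it forces on \<open>p\<close> is \<open>- s\<close>.\<close>
    define M' where "M' i z' = M i z' - M i z / M p z * M p z'" for i z'
    have "card Z < card (I - {p})"
      using insert.prems insert.hyps p by (simp add: card_Diff_singleton)
    then obtain c where c: "\<exists>i\<in>I - {p}. c i \<noteq> 0"
      "\<forall>z'\<in>Z. (\<Sum>i\<in>I - {p}. c i * M' i z') = 0"
      using insert.IH[of "I - {p}" M'] insert.prems by auto
    define s where "s = (\<Sum>i\<in>I - {p}. c i * M i z) / M p z"
    define c' where "c' = c(p := - s)"
    have split: "(\<Sum>i\<in>I. c' i * M i z') = - s * M p z' + (\<Sum>i\<in>I - {p}. c i * M i z')" for z'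
      using p insert.prems by (subst sum.remove[of _ p]) (auto simp: c'_def intro!: sum.cong)
    have "(\<Sum>i\<in>I. c' i * M i z) = 0"
      using p by (simp add: split s_def)
    moreover have "(\<Sum>i\<in>I. c' i * M i z') = 0" if "z' \<in> Z" for z'
    proof -
      have "(\<Sum>i\<in>I - {p}. c i * M' i z')
          = (\<Sum>i\<in>I - {p}. c i * M i z') - s * M p z'"
        by (simp add: M'_def s_def algebra_simps sum_subtractf sum_distrib_left sum_distrib_right
            sum_divide_distrib)
      then show ?thesis using c that by (simp add: split)
    qed
    moreover have "\<exists>i\<in>I. c' i \<noteq> 0" using c(1) by (auto simp: c'_def)
    ultimately show ?thesis by (intro exI[of _ c']) auto
  qed
qed

definition orthonormal_on :: "'i set \<Rightarrow> ('i \<Rightarrow> complex^'d) \<Rightarrow> bool" where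
  "orthonormal_on I v \<longleftrightarrow> (\<forall>i\<in>I. \<forall>j\<in>I. cinner (v i) (v j) = (if i = j then 1 else 0))"

lemma orthonormal_onD:
  "orthonormal_on I v \<Longrightarrow> i \<in> I \<Longrightarrow> j \<in> I \<Longrightarrow> cinner (v i) (v j) = (if i = j then 1 else 0)"
  by (auto simp: orthonormal_on_def)

lemma orthonormal_on_subset: "orthonormal_on I v \<Longrightarrow> J \<subseteq> I \<Longrightarrow> orthonormal_on J v"
  unfolding orthonormal_on_def by blast

lemma orthonormal_on_norm:
  assumes "orthonormal_on I v" "i \<in> I"
  shows "norm (v i) = 1"
proof -
  have "complex_of_real ((norm (v i))\<^sup>2) = complex_of_real 1"
    using orthonormal_onD[OF assms(1,2,2)] by (simp only: cinner_self of_real_1 if_True refl)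
  then have "(norm (v i))\<^sup>2 = 1" by (simp only: of_real_eq_iff)
  then show ?thesis by (simp add: power2_eq_1_iff) (metis norm_ge_zero le_minus_one_simps(3))
qed

lemma cinner_sum_orthonormal:
  assumes "orthonormal_on I v" "finite I" "j \<in> I"
  shows "cinner (\<Sum>i\<in>I. c i *s v i) (v j) = c j"
proof -
  have "cinner (\<Sum>i\<in>I. c i *s v i) (v j) = (\<Sum>i\<in>I. if i = j then c i else 0)"
    unfolding cinner_linear using assms by (intro sum.cong) (auto simp: orthonormal_onD)
  then show ?thesis using assms by simp
qed

lemma bessel:
  assumes "orthonormal_on I v" "finite I"
  shows "(\<Sum>i\<in>I. (cmod (cinner x (v i)))\<^sup>2) \<le> (norm x)\<^sup>2"
proof -
  define y where "y = (\<Sum>i\<in>I. cinner x (v i) *s v i)"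
  have yv: "cinner y (v i) = cinner x (v i)" if "i \<in> I" for i
    unfolding y_def by (rule cinner_sum_orthonormal[OF assms that])
  have xy: "cinner x y = complex_of_real (\<Sum>i\<in>I. (cmod (cinner x (v i)))\<^sup>2)"
    unfolding y_def cinner_linear
    by (simp add: complex_norm_square cnj_cinner mult_ac del: of_real_power)
  have "cinner y y = cinner x y"
  proof -
    have "cinner y z = (\<Sum>i\<in>I. cinner x (v i) * cinner (v i) z)" for z
      by (simp add: y_def cinner_linear)
    moreover have "cinner x y = (\<Sum>i\<in>I. cinner x (v i) * cinner (v i) x)"
      by (simp add: y_def cinner_linear cnj_cinner mult.commute)
    moreover have "cinner (v i) y = cinner (v i) x" if "i \<in> I" for i
      using yv[OF that] cnj_cinner by metis
    ultimately show ?thesis by simp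
  qed
  then have "cinner (x - y) (x - y) = cinner x x - cinner x y - cnj (cinner x y) + cinner x y"
    by (simp add: cinner_linear cnj_cinner)
  then have "cinner (x - y) (x - y) = cinner x x - cinner x y"
    by (simp add: xy)
  then have "complex_of_real ((norm (x - y))\<^sup>2)
      = complex_of_real ((norm x)\<^sup>2 - (\<Sum>i\<in>I. (cmod (cinner x (v i)))\<^sup>2))"
    unfolding cinner_self xy by simp
  then have "(norm (x - y))\<^sup>2 = (norm x)\<^sup>2 - (\<Sum>i\<in>I. (cmod (cinner x (v i)))\<^sup>2)"
    by (simp only: of_real_eq_iff)
  then show ?thesis by (metis diff_ge_0_iff_ge zero_le_power2)
qed

text \<open>A nonzero residual \<open>y\<close> would be orthogonal to every \<open>v i\<close>.
  Together with them (index \<open>None\<close> stands for \<open>y\<close>) it would make one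
  vector more than the dimension, hence a linear dependence, whose coefficients all vanish by
  orthogonality.\<close>

lemma orthonormal_expansion:
  fixes v :: "'i \<Rightarrow> complex^'d"
  assumes on: "orthonormal_on I v" and card: "card I = CARD('d)"
  shows "(\<Sum>i\<in>I. cinner x (v i) *s v i) = x"
proof (rule ccontr)
  have fin: "finite I" using card by (metis card.infinite zero_neq_one zero_less_card_finite less_irrefl)
  assume neq: "(\<Sum>i\<in>I. cinner x (v i) *s v i) \<noteq> x"
  define y where "y = x - (\<Sum>i\<in>I. cinner x (v i) *s v i)"
  have y0: "y \<noteq> 0" using neq by (simp add: y_def)
  have yv: "cinner y (v i) = 0" if "i \<in> I" for i
    using cinner_sum_orthonormal[OF on fin that, of "\<lambda>i. cinner x (v i)"]
    by (simp add: y_def cinner_diff_left)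
  define u where "u j = (case j of None \<Rightarrow> y | Some i \<Rightarrow> v i)" for j
  define J where "J = insert None (Some ` I)"
  have "card J = Suc (card I)" using fin by (simp add: J_def card_image)
  then obtain c where c: "\<exists>j\<in>J. c j \<noteq> 0"
    "\<forall>k\<in>UNIV::'d set. (\<Sum>j\<in>J. c j * u j $ k) = 0"
    using nontrivial_solution[of "UNIV::'d set" J "\<lambda>j k. u j $ k"] card fin
    by (auto simp: J_def)
  have sum0: "(\<Sum>j\<in>J. c j *s u j) = 0"
    using c(2) by (simp add: vec_eq_iff)
  then have split0: "c None *s y + (\<Sum>i\<in>I. c (Some i) *s v i) = 0"
    using fin by (simp add: J_def sum.reindex u_def)
  have "c (Some i) = 0" if "i \<in> I" for i
  proof -
    have "cinner (c None *s y + (\<Sum>i\<in>I. c (Some i) *s v i)) (v i) = 0"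
      using split0 by simp
    then show ?thesis
      using cinner_sum_orthonormal[OF on fin that, of "\<lambda>i. c (Some i)"] yv[OF that]
      by (simp add: cinner_add_left cinner_scale_left)
  qed
  moreover have "c None = 0"
    using split0 calculation y0 by simp
  ultimately show False using c(1) by (auto simp: J_def)
qed

lemma parseval:
  fixes v :: "'i \<Rightarrow> complex^'d"
  assumes "orthonormal_on I v" "card I = CARD('d)"
  shows "(\<Sum>i\<in>I. (cmod (cinner x (v i)))\<^sup>2) = (norm x)\<^sup>2"
proof -
  have "cinner x x = cinner x (\<Sum>i\<in>I. cinner x (v i) *s v i)"
    by (simp only: orthonormal_expansion[OF assms])
  also have "\<dots> = complex_of_real (\<Sum>i\<in>I. (cmod (cinner x (v i)))\<^sup>2)"
    unfolding cinner_linear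
    by (simp add: complex_norm_square cnj_cinner mult_ac del: of_real_power)
  finally show ?thesis unfolding cinner_self by (metis of_real_eq_iff)
qed

section \<open>The spectral theorem by successive Rayleigh maximisation\<close>

lemma rayleigh_maximizer_exists:
  fixes A :: "complex^'d^'d" and v :: "nat \<Rightarrow> complex^'d"
  assumes "k < CARD('d)"
  obtains x where "norm x = 1" "\<forall>j\<in>{1..k}. cinner x (v j) = 0"
    "\<And>y. norm y = 1 \<Longrightarrow> (\<forall>j\<in>{1..k}. cinner y (v j) = 0) \<Longrightarrow>
      Re (cinner (A *v y) y) \<le> Re (cinner (A *v x) x)"
proof -
  define T where "T = {x. norm x = 1 \<and> (\<forall>j\<in>{1..k}. cinner x (v j) = 0)}"
  have cont: "continuous_on UNIV (\<lambda>x. cinner x (v j))" for j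
    unfolding cinner_def by (intro continuous_intros)
  have "T = sphere 0 1 \<inter> (\<Inter>j\<in>{1..k}. {x. cinner x (v j) = 0})"
    by (auto simp: T_def)
  moreover have "closed (\<Inter>j\<in>{1..k}. {x. cinner x (v j) = 0})"
    by (intro closed_INT ballI closed_Collect_eq cont continuous_on_const)
  ultimately have "compact T" by (simp add: compact_Int_closed)
  moreover have "T \<noteq> {}"
  proof -
    \<comment> \<open>There are more coordinates of \<open>x\<close> than the \<open>k\<close>
      orthogonality conditions.\<close>
    obtain c where c: "\<exists>i\<in>(UNIV::'d set). c i \<noteq> 0"
      "\<forall>j\<in>{1..k}. (\<Sum>i\<in>UNIV. c i * cnj (v j $ i)) = 0"
      using nontrivial_solution[of "{1..k}" "UNIV::'d set" "\<lambda>i j. cnj (v j $ i)"] assms by auto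
    define x where "x = (\<chi> i. c i)"
    have "x \<noteq> 0" using c(1) by (auto simp: x_def vec_eq_iff)
    moreover have "cinner x (v j) = 0" if "j \<in> {1..k}" for j
      using c(2) that by (simp add: cinner_def x_def)
    ultimately have "complex_of_real (inverse (norm x)) *s x \<in> T"
      by (auto simp: T_def cinner_scale_left norm_scale_of_real simp del: of_real_inverse)
    then show ?thesis by blast
  qed
  moreover have "continuous_on T (\<lambda>x. Re (cinner (A *v x) x))"
    unfolding cinner_def matrix_vector_mult_def by (intro continuous_intros)
  ultimately obtain x where "x \<in> T" "\<forall>y\<in>T. Re (cinner (A *v y) y) \<le> Re (cinner (A *v x) x)"
    using continuous_attains_sup by blast
  then show ?thesis by (intro that[of x]) (auto simp: T_def)
qed

text \<open>Stands in for the limit of \<open>\<epsilon>\<close> to 0: a positive \<open>q\<close>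
  is refuted at \<open>\<epsilon> = q / C\<close>.\<close>

lemma nonpos_of_le_small_multiple:
  fixes q C :: real
  assumes "\<And>\<epsilon>. 0 < \<epsilon> \<Longrightarrow> 2 * q \<le> \<epsilon> * C"
  shows "q \<le> 0"
proof (rule ccontr)
  assume q: "\<not> q \<le> 0"
  have "0 < C" using assms[of 1] q by linarith
  then have "2 * q \<le> q / C * C" using q by (intro assms) auto
  then show False using q \<open>0 < C\<close> by simp
qed

text \<open>First variation: the residual \<open>y\<close> of the eigenvalue equation is again
  orthogonal to the earlier eigenvectors, so \<open>x\<close> may be perturbed by a multiple
  \<open>\<epsilon>\<close> of \<open>y\<close>. The linear coefficient of the gain is
  \<open>2 * (norm y)\<^sup>2\<close>, and maximality leaves only \<open>y = 0\<close>.\<close>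

lemma rayleigh_maximizer_eigenvector:
  fixes A :: "complex^'d^'d"
  assumes herm: "adj A = A"
    and eig: "\<forall>j\<in>{1..k}. A *v v j = complex_of_real (b j) *s v j"
    and x: "norm x = 1" "\<forall>j\<in>{1..k}. cinner x (v j) = 0"
    and max: "\<And>y. norm y = 1 \<Longrightarrow> (\<forall>j\<in>{1..k}. cinner y (v j) = 0) \<Longrightarrow>
      Re (cinner (A *v y) y) \<le> Re (cinner (A *v x) x)"
  shows "A *v x = complex_of_real (Re (cinner (A *v x) x)) *s x"
proof -
  define \<beta> where "\<beta> = Re (cinner (A *v x) x)"
  define y where "y = A *v x - complex_of_real \<beta> *s x"
  have perp: "\<forall>j\<in>{1..k}. cinner y (v j) = 0"
    using eig x(2) by (auto simp: y_def cinner_linear cinner_hermitian[OF herm])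
  \<comment> \<open>The homogeneous form of maximality spares normalising the perturbed
    vector.\<close>
  have quad: "Re (cinner (A *v z) z) \<le> \<beta> * (norm z)\<^sup>2" if "\<forall>j\<in>{1..k}. cinner z (v j) = 0" for z
  proof (cases "z = 0")
    case False
    define z' where "z' = complex_of_real (inverse (norm z)) *s z"
    have "Re (cinner (A *v z') z') \<le> \<beta>"
      unfolding \<beta>_def using False that
      by (intro max) (auto simp: z'_def norm_scale_of_real cinner_scale_left simp del: of_real_inverse)
    then show ?thesis using False
      by (simp add: z'_def matrix_vector_mult_scale cinner_linear divide_simps power2_eq_square
          del: of_real_inverse)
  qed simp
  define C where "C = \<beta> * (norm y)\<^sup>2 - Re (cinner (A *v y) y)"
  have main: "2 * (norm y)\<^sup>2 \<le> \<epsilon> * C" if "\<epsilon> > 0" for \<epsilon> :: real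
  proof -
    define z where "z = x + complex_of_real \<epsilon> *s y"
    have "\<forall>j\<in>{1..k}. cinner z (v j) = 0"
      using perp x(2) by (simp add: z_def cinner_linear)
    then have 1: "Re (cinner (A *v z) z) \<le> \<beta> * (norm z)\<^sup>2" by (rule quad)
    have arith: "e * (e * (b * n - r)) - e * (2 * (p - b * q))
        = b * (1 + 2 * e * q + e\<^sup>2 * n) - (b + 2 * e * p + e\<^sup>2 * r)" for b e n p q r :: real
      by (simp add: algebra_simps power2_eq_square)
    have e1: "Re (cinner (A *v z) z) = \<beta> + 2 * \<epsilon> * Re (cinner (A *v x) y) + \<epsilon>\<^sup>2 * Re (cinner (A *v y) y)"
    proof -
      have "Re (cinner (A *v z) z) = Re (cinner (A *v x) x)
          + \<epsilon> * (Re (cinner (A *v x) y) + Re (cinner (A *v y) x)) + \<epsilon>\<^sup>2 * Re (cinner (A *v y) y)"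
        by (simp add: z_def matrix_vector_right_distrib matrix_vector_mult_scale cinner_linear
            power2_eq_square algebra_simps)
      also have "Re (cinner (A *v y) x) = Re (cinner (A *v x) y)"
        unfolding cinner_hermitian[OF herm, of y x] Re_cinner by (rule inner_commute)
      finally show ?thesis by (simp add: \<beta>_def algebra_simps)
    qed
    have e2: "(norm z)\<^sup>2 = 1 + 2 * \<epsilon> * Re (cinner x y) + \<epsilon>\<^sup>2 * (norm y)\<^sup>2"
    proof -
      have "(norm z)\<^sup>2 = Re (cinner z z)" by (simp add: cinner_self)
      also have "\<dots> = (norm x)\<^sup>2 + \<epsilon> * (Re (cinner x y) + Re (cinner y x)) + \<epsilon>\<^sup>2 * (norm y)\<^sup>2"
        by (simp add: z_def cinner_linear cinner_self[of x] cinner_self[of y] power2_eq_square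
            algebra_simps del: of_real_power)
      also have "Re (cinner y x) = Re (cinner x y)" unfolding Re_cinner by (rule inner_commute)
      finally show ?thesis using x(1) by (simp add: algebra_simps)
    qed
    have e3: "(norm y)\<^sup>2 = Re (cinner (A *v x) y) - \<beta> * Re (cinner x y)"
    proof -
      have "(norm y)\<^sup>2 = Re (cinner y y)" by (simp add: cinner_self)
      also have "\<dots> = Re (cinner (A *v x) y) - \<beta> * Re (cinner x y)"
        by (subst (1) y_def) (simp add: cinner_linear)
      finally show ?thesis .
    qed
    have "\<epsilon> * (2 * (Re (cinner (A *v x) y) - \<beta> * Re (cinner x y))) \<le> \<epsilon> * (\<epsilon> * C)"
    proof -
      have "\<epsilon> * (\<epsilon> * C) - \<epsilon> * (2 * (Re (cinner (A *v x) y) - \<beta> * Re (cinner x y)))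
          = \<beta> * (norm z)\<^sup>2 - Re (cinner (A *v z) z)"
        unfolding e1 e2 C_def by (rule arith)
      also have "\<dots> \<ge> 0" by (rule iffD2[OF diff_ge_0_iff_ge 1])
      finally show ?thesis by (rule iffD1[OF diff_ge_0_iff_ge])
    qed
    then have "\<epsilon> * (2 * (norm y)\<^sup>2) \<le> \<epsilon> * (\<epsilon> * C)"
      by (simp only: e3)
    then show ?thesis using that by simp
  qed
  have "(norm y)\<^sup>2 \<le> 0" by (rule nonpos_of_le_small_multiple[OF main])
  then have "y = 0" by simp
  then show ?thesis by (simp add: y_def \<beta>_def)
qed

text \<open>No order is imposed on \<open>b\<close>, because the eigenvalues
  \<open>a i - r i\<close> of the optimal difference are listed in the order of \<open>a\<close>.
  Sortedness is assumed separately where it matters.\<close>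

definition eigensystem :: "complex^'d^'d \<Rightarrow> (nat \<Rightarrow> real) \<Rightarrow> (nat \<Rightarrow> complex^'d) \<Rightarrow> bool" where
  "eigensystem A b v \<longleftrightarrow> orthonormal_on {1..CARD('d)} v \<and>
     (\<forall>i\<in>{1..CARD('d)}. A *v v i = complex_of_real (b i) *s v i)"

theorem hermitian_eigensystem:
  fixes A :: "complex^'d^'d"
  assumes herm: "adj A = A"
  obtains b v where "eigensystem A b v" "antimono_on {1..CARD('d)} b"
proof -
  \<comment> \<open>The last clause is what orders the eigenvalues: for \<open>i \<le> j\<close> the
    vector \<open>v j\<close> was a competitor at stage \<open>i\<close>.\<close>
  have "\<exists>b v. orthonormal_on {1..k} v \<and> (\<forall>i\<in>{1..k}. A *v v i = complex_of_real (b i) *s v i) \<and>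
      (\<forall>i\<in>{1..k}. \<forall>y. norm y = 1 \<longrightarrow> (\<forall>j\<in>{1..<i}. cinner y (v j) = 0) \<longrightarrow>
         Re (cinner (A *v y) y) \<le> b i)" if "k \<le> CARD('d)" for k
    using that
  proof (induction k)
    case 0
    show ?case by (auto simp: orthonormal_on_def)
  next
    case (Suc k)
    then obtain b v where bv: "orthonormal_on {1..k} v"
      "\<forall>i\<in>{1..k}. A *v v i = complex_of_real (b i) *s v i"
      "\<forall>i\<in>{1..k}. \<forall>y. norm y = 1 \<longrightarrow> (\<forall>j\<in>{1..<i}. cinner y (v j) = 0) \<longrightarrow>
         Re (cinner (A *v y) y) \<le> b i" by auto
    obtain x where x: "norm x = 1" "\<forall>j\<in>{1..k}. cinner x (v j) = 0"
      and max: "\<And>y. norm y = 1 \<Longrightarrow> (\<forall>j\<in>{1..k}. cinner y (v j) = 0) \<Longrightarrow>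
      Re (cinner (A *v y) y) \<le> Re (cinner (A *v x) x)"
      using rayleigh_maximizer_exists[of k v A] Suc.prems by (metis Suc_le_lessD)
    define \<beta> where "\<beta> = Re (cinner (A *v x) x)"
    have ev: "A *v x = complex_of_real \<beta> *s x"
      unfolding \<beta>_def by (rule rayleigh_maximizer_eigenvector[OF herm bv(2) x max])
    have xv: "\<forall>j\<in>{1..k}. cinner (v j) x = 0"
      using x(2) by (simp add: cinner_eq_zero_commute)
    have "cinner x x = 1" using x(1) by (simp add: cinner_self)
    then have "orthonormal_on {1..Suc k} (v(Suc k := x))"
      using bv(1) x(2) xv unfolding orthonormal_on_def by (auto simp: atLeastAtMostSuc_conv)
    moreover have "\<forall>i\<in>{1..Suc k}. A *v (v(Suc k := x)) i
        = complex_of_real ((b(Suc k := \<beta>)) i) *s (v(Suc k := x)) i"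
      using bv(2) ev by (auto simp: atLeastAtMostSuc_conv)
    moreover have "\<forall>i\<in>{1..Suc k}. \<forall>y. norm y = 1 \<longrightarrow>
        (\<forall>j\<in>{1..<i}. cinner y ((v(Suc k := x)) j) = 0) \<longrightarrow>
        Re (cinner (A *v y) y) \<le> (b(Suc k := \<beta>)) i"
    proof (intro ballI allI impI)
      fix i y
      assume i: "i \<in> {1..Suc k}" and y: "norm y = 1"
        "\<forall>j\<in>{1..<i}. cinner y ((v(Suc k := x)) j) = 0"
      have y': "\<forall>j\<in>{1..<i}. cinner y (v j) = 0"
        using y(2) i by auto
      show "Re (cinner (A *v y) y) \<le> (b(Suc k := \<beta>)) i"
      proof (cases "i = Suc k")
        case True
        then show ?thesis using max[OF y(1)] y' by (auto simp: \<beta>_def)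
      next
        case False
        then show ?thesis using bv(3) i y(1) y' by auto
      qed
    qed
    ultimately show ?case by blast
  qed
  from this[of "CARD('d)"] obtain b v where bv: "orthonormal_on {1..CARD('d)} v"
      "\<forall>i\<in>{1..CARD('d)}. A *v v i = complex_of_real (b i) *s v i"
      "\<forall>i\<in>{1..CARD('d)}. \<forall>y. norm y = 1 \<longrightarrow> (\<forall>j\<in>{1..<i}. cinner y (v j) = 0) \<longrightarrow>
         Re (cinner (A *v y) y) \<le> b i" by auto
  have "b j \<le> b i" if ij: "i \<in> {1..CARD('d)}" "j \<in> {1..CARD('d)}" "i \<le> j" for i j
  proof (cases "i = j")
    case False
    have "Re (cinner (A *v v j) (v j)) \<le> b i"
      using bv(3) ij False orthonormal_on_norm[OF bv(1)]
      by (auto simp: orthonormal_onD[OF bv(1)])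
    then show ?thesis using ij bv(2) orthonormal_onD[OF bv(1), of j j]
      by (simp add: cinner_scale_left)
  qed simp
  then have "antimono_on {1..CARD('d)} b" by (auto simp: monotone_on_def)
  then show ?thesis using bv that unfolding eigensystem_def by blast
qed

section \<open>Majorisation by transfers\<close>

lemma sum_transfer:
  fixes \<mu> :: "'i \<Rightarrow> real"
  assumes "finite I" "i \<in> I" "j \<in> I" "i \<noteq> j"
  shows "sum (\<mu>(i := \<mu> i - \<delta>, j := \<mu> j + \<delta>)) I = sum \<mu> I"
proof -
  have "(\<mu>(i := \<mu> i - \<delta>, j := \<mu> j + \<delta>)) l
      = \<mu> l + ((if l = j then \<delta> else 0) - (if l = i then \<delta> else 0))" for l
    using assms(4) by auto
  then have "sum (\<mu>(i := \<mu> i - \<delta>, j := \<mu> j + \<delta>)) I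
      = (\<Sum>l\<in>I. \<mu> l + ((if l = j then \<delta> else 0) - (if l = i then \<delta> else 0)))"
    by (intro sum.cong) auto
  then show ?thesis using assms by (simp add: sum.distrib sum_subtractf)
qed

text \<open>Termination measure of the two chains below: a transfer is sized so that one of its two
  entries reaches its target, and both entries were off target before.\<close>

lemma card_mismatch_less:
  assumes "finite I" "l \<in> I" "\<mu> l \<noteq> w l" "\<mu>' l = w l"
    and "\<And>i. i \<in> I \<Longrightarrow> \<mu> i = w i \<Longrightarrow> \<mu>' i = w i"
  shows "card {i\<in>I. \<mu>' i \<noteq> w i} < card {i\<in>I. \<mu> i \<noteq> w i}"
  using assms by (intro psubset_card_mono) auto

lemma sum_less_of_le_ne:
  fixes f g :: "'i \<Rightarrow> real"
  assumes "finite I" "\<And>i. i \<in> I \<Longrightarrow> f i \<le> g i" "l \<in> I" "f l \<noteq> g l"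
  shows "sum f I < sum g I"
proof (rule sum_strict_mono_ex1)
  show "\<exists>i\<in>I. f i < g i" using assms by (intro bexI[of _ l]) (auto simp: less_le)
qed (use assms in auto)

text \<open>While some entry differs from the mean \<open>c\<close>, one entry lies above it and
  another below, and they exchange the smaller of the two deviations. This is used for the rows of
  an operator, which are indexed by an unordered type.\<close>

lemma transfer_chain_constant:
  fixes \<mu> :: "'i \<Rightarrow> real"
  assumes fin: "finite I"
    and step: "\<And>\<mu> i j \<delta>. Q \<mu> \<Longrightarrow> i \<in> I \<Longrightarrow> j \<in> I \<Longrightarrow> i \<noteq> j \<Longrightarrow> 0 < \<delta> \<Longrightarrow> \<delta> < \<mu> i - \<mu> j \<Longrightarrow>
      Q (\<mu>(i := \<mu> i - \<delta>, j := \<mu> j + \<delta>))"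
    and "Q \<mu>" "sum \<mu> I = real (card I) * c"
  shows "\<exists>\<mu>'. Q \<mu>' \<and> (\<forall>i\<in>I. \<mu>' i = c)"
  using assms(3,4)
proof (induction "card {i\<in>I. \<mu> i \<noteq> c}" arbitrary: \<mu> rule: less_induct)
  case less
  show ?case
  proof (cases "\<forall>i\<in>I. \<mu> i = c")
    case True
    then show ?thesis using less.prems by blast
  next
    case False
    then obtain l where l: "l \<in> I" "\<mu> l \<noteq> c" by blast
    have "\<exists>i\<in>I. \<mu> i > c"
    proof (rule ccontr)
      assume "\<not> (\<exists>i\<in>I. \<mu> i > c)"
      then have "sum \<mu> I < (\<Sum>i\<in>I. c)"
        using l fin by (intro sum_less_of_le_ne[of _ _ _ l]) (auto simp: not_less)
      then show False using less.prems by simp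
    qed
    then obtain i where i: "i \<in> I" "\<mu> i > c" by blast
    have "\<exists>j\<in>I. \<mu> j < c"
    proof (rule ccontr)
      assume "\<not> (\<exists>j\<in>I. \<mu> j < c)"
      then have "(\<Sum>i\<in>I. c) < sum \<mu> I"
        using l fin by (intro sum_less_of_le_ne[of _ _ _ l]) (auto simp: not_less)
      then show False using less.prems by simp
    qed
    then obtain j where j: "j \<in> I" "\<mu> j < c" by blast
    have ij: "i \<noteq> j" using i j by auto
    define \<delta> where "\<delta> = min (\<mu> i - c) (c - \<mu> j)"
    define \<mu>' where "\<mu>' = \<mu>(i := \<mu> i - \<delta>, j := \<mu> j + \<delta>)"
    have "0 < \<delta>" "\<delta> < \<mu> i - \<mu> j" using i j by (auto simp: \<delta>_def)
    then have "Q \<mu>'" unfolding \<mu>'_def using i j ij less.prems by (intro step) auto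
    moreover have "sum \<mu>' I = real (card I) * c"
      unfolding \<mu>'_def using sum_transfer[OF fin i(1) j(1) ij] less.prems by simp
    moreover have "card {i\<in>I. \<mu>' i \<noteq> c} < card {i\<in>I. \<mu> i \<noteq> c}"
    proof (cases "\<mu> i - c \<le> c - \<mu> j")
      case True
      then show ?thesis using i j ij fin
        by (intro card_mismatch_less[where l=i and w="\<lambda>_. c"]) (auto simp: \<mu>'_def \<delta>_def)
    next
      case False
      then show ?thesis using i j ij fin
        by (intro card_mismatch_less[where l=j and w="\<lambda>_. c"]) (auto simp: \<mu>'_def \<delta>_def)
    qed
    ultimately show ?thesis using less.hyps by blast
  qed
qed

text \<open>Hardy--Littlewood--Polya. The transfers are strict, that is, they neither fix the two
  entries nor interchange them; this is what yields strict inequalities between norms.\<close>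

lemma transfer_chain:
  fixes \<mu> :: "nat \<Rightarrow> real"
  assumes step: "\<And>\<mu> i j \<delta>. Q \<mu> \<Longrightarrow> i \<in> {1..L} \<Longrightarrow> j \<in> {1..L} \<Longrightarrow> i \<noteq> j \<Longrightarrow> 0 < \<delta> \<Longrightarrow>
      \<delta> < \<mu> i - \<mu> j \<Longrightarrow> Q (\<mu>(i := \<mu> i - \<delta>, j := \<mu> j + \<delta>))"
    and w: "antimono_on {1..L} w"
    and "Q \<mu>"
    and "\<And>k. k \<le> L \<Longrightarrow> sum w {1..k} \<le> sum \<mu> {1..k}"
    and "sum w {1..L} = sum \<mu> {1..L}"
  shows "\<exists>\<mu>'. Q \<mu>' \<and> (\<forall>i\<in>{1..L}. \<mu>' i = w i)"
  using assms(3-5)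
proof (induction "card {i\<in>{1..L}. \<mu> i \<noteq> w i}" arbitrary: \<mu> rule: less_induct)
  case less
  show ?case
  proof (cases "\<forall>i\<in>{1..L}. \<mu> i = w i")
    case True
    then show ?thesis using less.prems by blast
  next
    case False
    then obtain l where l: "l \<in> {1..L}" "\<mu> l \<noteq> w l" by blast
    have "\<exists>j. j \<in> {1..L} \<and> \<mu> j < w j"
    proof (rule ccontr)
      assume "\<not> (\<exists>j. j \<in> {1..L} \<and> \<mu> j < w j)"
      then have "sum w {1..L} < sum \<mu> {1..L}"
        using l by (intro sum_less_of_le_ne[of _ _ _ l]) (auto simp: not_less)
      then show False using less.prems by simp
    qed
    \<comment> \<open>All entries before the first deficient \<open>j\<close> reach their targets,
      so the partial sum condition at \<open>j\<close> forces a surplus at some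
      \<open>i < j\<close>. After the transfer the entries before \<open>j\<close> still reach their
      targets, which preserves the conditions for \<open>k < j\<close>.\<close>
    then obtain j where j: "j \<in> {1..L} \<and> \<mu> j < w j"
      and "\<forall>l<j. \<not> (l \<in> {1..L} \<and> \<mu> l < w l)"
      unfolding exists_least_iff[of "\<lambda>j. j \<in> {1..L} \<and> \<mu> j < w j"] by blast
    then have least: "\<And>l. l \<in> {1..L} \<Longrightarrow> l < j \<Longrightarrow> w l \<le> \<mu> l" by (simp add: not_less)
    have "\<exists>i. i \<in> {1..<j} \<and> \<mu> i > w i"
    proof (rule ccontr)
      assume "\<not> (\<exists>i. i \<in> {1..<j} \<and> \<mu> i > w i)"
      then have "\<mu> i \<le> w i" if "i \<in> {1..j}" for i
        using j that by (cases "i = j") (auto simp: not_less)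
      then have "sum \<mu> {1..j} < sum w {1..j}"
        using j by (intro sum_less_of_le_ne[of _ _ _ j]) auto
      then show False using less.prems(2)[of j] j by simp
    qed
    then obtain i where i: "i \<in> {1..<j}" "\<mu> i > w i" by blast
    have ij: "i \<noteq> j" "i \<in> {1..L}" using i j by auto
    have wij: "w j \<le> w i" using w i j by (auto simp: monotone_on_def)
    define \<delta> where "\<delta> = min (\<mu> i - w i) (w j - \<mu> j)"
    define \<mu>' where "\<mu>' = \<mu>(i := \<mu> i - \<delta>, j := \<mu> j + \<delta>)"
    \<comment> \<open>The transfer is strict since \<open>\<delta> \<le> \<mu> i - w i \<le> \<mu> i
      - w j < \<mu> i - \<mu> j\<close>; this is where the target must be decreasing.\<close>
    have "0 < \<delta>" "\<delta> < \<mu> i - \<mu> j" using i j wij by (auto simp: \<delta>_def)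
    then have "Q \<mu>'" unfolding \<mu>'_def using i j ij less.prems by (intro step) auto
    moreover have sum_eq: "sum \<mu>' {1..k} = sum \<mu> {1..k}" if "j \<le> k" for k
      unfolding \<mu>'_def using that i j ij by (intro sum_transfer) auto
    moreover have "sum w {1..k} \<le> sum \<mu>' {1..k}" if "k \<le> L" for k
    proof (cases "j \<le> k")
      case True
      then show ?thesis using less.prems(2)[OF that] sum_eq by simp
    next
      case False
      then show ?thesis using that least
        by (intro sum_mono) (auto simp: \<mu>'_def \<delta>_def)
    qed
    moreover have "card {i\<in>{1..L}. \<mu>' i \<noteq> w i} < card {i\<in>{1..L}. \<mu> i \<noteq> w i}"
    proof (cases "\<mu> i - w i \<le> w j - \<mu> j")
      case True
      then show ?thesis using i j ij
        by (intro card_mismatch_less[where l=i and w=w]) (auto simp: \<mu>'_def \<delta>_def)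
    next
      case False
      then show ?thesis using i j ij
        by (intro card_mismatch_less[where l=j and w=w]) (auto simp: \<mu>'_def \<delta>_def)
    qed
    ultimately show ?thesis using less.hyps less.prems(3) j by auto
  qed
qed

definition excess :: "nat \<Rightarrow> (nat \<Rightarrow> real) \<Rightarrow> real \<Rightarrow> real" where
  "excess n x t = (\<Sum>i\<in>{1..n}. max 0 (x i - t))"

text \<open>That \<open>x\<close> is majorised by \<open>y\<close> means that the sums agree and \<open>excess n x t \<le> excess n y t\<close> for
  all \<open>t\<close>; this form of majorisation needs no rearrangement.\<close>

lemma partial_sums_le_of_excess_le:
  assumes y: "antimono_on {1..n} y"
    and excess: "\<And>t. excess n x t \<le> excess n y t"
    and k: "k \<le> n"
  shows "sum x {1..k} \<le> sum y {1..k}"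
proof (cases "k = 0")
  case False
  \<comment> \<open>At this threshold only the first \<open>k\<close> entries of \<open>y\<close>
    can contribute to its excess.\<close>
  define t where "t = y k"
  have y_le: "y j \<le> y i" if "1 \<le> i" "i \<le> j" "j \<le> n" for i j
    using y that by (auto simp: monotone_on_def)
  have "(\<Sum>i\<in>{1..k}. x i - t) \<le> (\<Sum>i\<in>{1..k}. max 0 (x i - t))"
    by (intro sum_mono) auto
  also have "\<dots> \<le> excess n x t"
    unfolding excess_def using k by (intro sum_mono2) auto
  also have "\<dots> \<le> excess n y t" by (rule excess)
  also have "\<dots> = (\<Sum>i\<in>{1..k}. max 0 (y i - t))"
    unfolding excess_def using y_le[of k] k False
    by (intro sum.mono_neutral_right) (auto simp: t_def max_def intro: antisym)
  also have "\<dots> = (\<Sum>i\<in>{1..k}. y i - t)"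
    using y_le[of _ k] k by (intro sum.cong) (auto simp: t_def max_def)
  finally show ?thesis by (simp add: sum_subtractf)
qed simp

section \<open>The optimal spectrum as a constrained least squares solution\<close>

text \<open>Candidate spectra of frame operators, paired with the eigenvectors of \<open>A\<close>
  by position and not sorted. With \<open>L\<close> at least \<open>n\<close> and \<open>w\<close>
  non-negative, the total also settles the partial sums for \<open>n \<le> k \<le> L\<close>. Fixing
  the value 0 outside \<open>{1..n}\<close> is what makes the set compact in the space of all
  sequences.\<close>

definition admissible :: "nat \<Rightarrow> nat \<Rightarrow> (nat \<Rightarrow> real) \<Rightarrow> (nat \<Rightarrow> real) set" where
  "admissible n L w = {r. (\<forall>i. 0 \<le> r i) \<and> (\<forall>i. i \<notin> {1..n} \<longrightarrow> r i = 0) \<and>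
     (\<forall>k<n. sum w {1..k} \<le> sum r {1..k}) \<and> sum r {1..n} = sum w {1..L}}"

text \<open>Non-negative entries of total \<open>W\<close> lie between 0 and \<open>W\<close>, so
  the set is closed in a product of compact intervals and points, which is compact by Tychonoff's
  theorem.\<close>

lemma compact_admissible: "compact (admissible n L w)"
proof -
  define W where "W = sum w {1..L}"
  define B where "B = (\<Pi>\<^sub>E i\<in>(UNIV::nat set). if i \<in> {1..n} then {0..W} else {0::real})"
  have "compactin (product_topology (\<lambda>i. euclidean) UNIV) B"
    unfolding B_def compactin_PiE by auto
  then have "compact B" by (simp add: euclidean_product_topology)
  moreover have cont: "continuous_on UNIV (\<lambda>x::nat \<Rightarrow> real. sum x {1..k})" for k
    by (intro continuous_intros continuous_on_product_coordinates)
  have "closed ((\<Inter>k\<in>{..<n}. {r. sum w {1..k} \<le> sum r {1..k}}) \<inter> {r. sum r {1..n} = W})"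
    by (intro closed_Int closed_INT ballI closed_Collect_le closed_Collect_eq cont continuous_on_const)
  moreover have "admissible n L w =
      B \<inter> ((\<Inter>k\<in>{..<n}. {r. sum w {1..k} \<le> sum r {1..k}}) \<inter> {r. sum r {1..n} = W})"
  proof -
    have le: "r i \<le> W" if "r \<in> admissible n L w" "i \<in> {1..n}" for r i
      using that member_le_sum[of i "{1..n}" r] by (auto simp: admissible_def W_def)
    show ?thesis
    proof (intro subset_antisym subsetI)
      fix r assume r: "r \<in> admissible n L w"
      then have "r \<in> B" using le[OF r] by (auto simp: B_def PiE_iff admissible_def)
      then show "r \<in> B \<inter> ((\<Inter>k\<in>{..<n}. {r. sum w {1..k} \<le> sum r {1..k}}) \<inter> {r. sum r {1..n} = W})"
        using r by (simp add: admissible_def W_def)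
    next
      fix r assume r: "r \<in> B \<inter> ((\<Inter>k\<in>{..<n}. {r. sum w {1..k} \<le> sum r {1..k}}) \<inter> {r. sum r {1..n} = W})"
      have B: "if i \<in> {1..n} then 0 \<le> r i \<and> r i \<le> W else r i = 0" for i
        using r by (auto simp: B_def PiE_iff split: if_split_asm)
      have "0 \<le> r i" for i using B[of i] by (cases "i \<in> {1..n}") simp_all
      moreover have "r i = 0" if "i \<notin> {1..n}" for i using B[of i] that by simp
      ultimately show "r \<in> admissible n L w"
        using r by (simp add: admissible_def W_def)
    qed
  qed
  ultimately show ?thesis by (simp only: compact_Int_closed)
qed

lemma admissible_nonempty:
  assumes "1 \<le> n" "n \<le> L" "\<And>i. 0 \<le> w i"
  shows "admissible n L w \<noteq> {}"
proof -
  define r where "r i = (if i = (1::nat) then sum w {1..L} else 0)" for i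
  have 1: "sum r {1..k} = sum w {1..L}" if "1 \<le> k" for k
    using that by (simp add: r_def)
  have "sum w {1..k} \<le> sum r {1..k}" if "k < n" for k
  proof (cases "k = 0")
    case False
    then show ?thesis using that assms by (subst 1) (auto intro!: sum_mono2)
  qed simp
  then have "r \<in> admissible n L w"
    using assms 1[of n] by (auto simp: admissible_def r_def intro: sum_nonneg)
  then show ?thesis by blast
qed

text \<open>Moving \<open>\<epsilon>\<close> from \<open>r i\<close> to \<open>r j\<close> changes
  the sum of squares by \<open>2 * \<epsilon> * (\<epsilon> - g)\<close>, where \<open>g\<close> is
  the amount by which the difference at \<open>j\<close> exceeds that at \<open>i\<close>. A
  positive \<open>g\<close> would allow a decrease.\<close>

lemma least_squares_transfer:
  fixes a :: "nat \<Rightarrow> real"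
  assumes min: "\<And>r'. r' \<in> C \<Longrightarrow> (\<Sum>l\<in>{1..n}. (a l - r l)\<^sup>2) \<le> (\<Sum>l\<in>{1..n}. (a l - r' l)\<^sup>2)"
    and ij: "i \<in> {1..n}" "j \<in> {1..n}" "i \<noteq> j" and "0 < \<epsilon>\<^sub>0"
    and transfer: "\<And>\<epsilon>. 0 < \<epsilon> \<Longrightarrow> \<epsilon> \<le> \<epsilon>\<^sub>0 \<Longrightarrow> r(i := r i - \<epsilon>, j := r j + \<epsilon>) \<in> C"
  shows "a j - r j \<le> a i - r i"
proof (rule ccontr)
  assume neg: "\<not> a j - r j \<le> a i - r i"
  define g where "g = (a j - r j) - (a i - r i)"
  define \<epsilon> where "\<epsilon> = min \<epsilon>\<^sub>0 (g / 2)"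
  have "0 < g" using neg by (simp add: g_def)
  then have \<epsilon>: "0 < \<epsilon>" "\<epsilon> \<le> \<epsilon>\<^sub>0" "2 * \<epsilon> \<le> g" using \<open>0 < \<epsilon>\<^sub>0\<close> by (auto simp: \<epsilon>_def)
  define r' where "r' = r(i := r i - \<epsilon>, j := r j + \<epsilon>)"
  have "(\<Sum>l\<in>{1..n}. (a l - r l)\<^sup>2) \<le> (\<Sum>l\<in>{1..n}. (a l - r' l)\<^sup>2)"
    unfolding r'_def using \<epsilon> by (intro min transfer)
  moreover have "(\<Sum>l\<in>{1..n}. (a l - r' l)\<^sup>2)
    = (\<Sum>l\<in>{1..n}. (a l - r l)\<^sup>2 + ((if l = i then (a i - r i + \<epsilon>)\<^sup>2 - (a i - r i)\<^sup>2 else 0)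
        + (if l = j then (a j - r j - \<epsilon>)\<^sup>2 - (a j - r j)\<^sup>2 else 0)))"
    using ij by (intro sum.cong) (auto simp: r'_def algebra_simps)
  ultimately have "0 \<le> ((a i - r i + \<epsilon>)\<^sup>2 - (a i - r i)\<^sup>2) + ((a j - r j - \<epsilon>)\<^sup>2 - (a j - r j)\<^sup>2)"
    using ij by (simp add: sum.distrib)
  also have "\<dots> = 2 * \<epsilon> * (\<epsilon> - g)"
    by (simp add: g_def power2_eq_square algebra_simps)
  finally show False using \<epsilon> by (simp add: zero_le_mult_iff)
qed

text \<open>The sequence \<open>r\<close> is the least squares approximation of \<open>a\<close>; the index \<open>k\<close> below is one
  where the partial sum constraint is active.\<close>

lemma optimal_spectrum:
  fixes a w :: "nat \<Rightarrow> real"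
  assumes n: "1 \<le> n" "n \<le> L" and w: "\<And>i. 0 \<le> w i"
  obtains r where "r \<in> admissible n L w"
    "\<And>t. excess n (\<lambda>i. a i - r i) t = 0 \<or>
      (\<exists>k<n. excess n (\<lambda>i. a i - r i) t \<le> (\<Sum>i\<in>{k<..n}. max 0 (a i - t)) - sum w {k<..L})"
proof -
  have "continuous_on (admissible n L w) (\<lambda>r. \<Sum>l\<in>{1..n}. (a l - r l)\<^sup>2)"
    by (intro continuous_intros continuous_on_subset[OF continuous_on_product_coordinates]) auto
  then obtain r where r: "r \<in> admissible n L w"
    and min: "\<And>r'. r' \<in> admissible n L w \<Longrightarrow>
      (\<Sum>l\<in>{1..n}. (a l - r l)\<^sup>2) \<le> (\<Sum>l\<in>{1..n}. (a l - r' l)\<^sup>2)"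
    using continuous_attains_inf[OF compact_admissible admissible_nonempty[of n L w, OF n w]]
    by blast
  define x where "x i = a i - r i" for i
  have r0: "0 \<le> r i" for i using r by (auto simp: admissible_def)
  \<comment> \<open>Mass moved from \<open>i\<close> to \<open>j\<close> lowers exactly the partial
    sums with \<open>i \<le> k < j\<close>, hence none if \<open>j < i\<close>. Where it can move,
    optimality forbids a larger difference at \<open>j\<close>.\<close>
  have transfer: "x j \<le> x i"
    if ij: "i \<in> {1..n}" "j \<in> {1..n}" "i \<noteq> j" and pos: "0 < r i"
      and slack: "\<And>k. k < n \<Longrightarrow> i \<le> k \<Longrightarrow> k < j \<Longrightarrow> sum w {1..k} < sum r {1..k}" for i j
  proof -
    \<comment> \<open>The largest amount allowed by the sign of \<open>r i\<close> and by the slack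
      of the lowered partial sums.\<close>
    define \<epsilon>\<^sub>0 where "\<epsilon>\<^sub>0 = Min (insert (r i) ((\<lambda>k. sum r {1..k} - sum w {1..k}) ` {k. k < n \<and> i \<le> k \<and> k < j}))"
    have fin: "finite {k. k < n \<and> i \<le> k \<and> k < j}" by simp
    have "0 < \<epsilon>\<^sub>0" unfolding \<epsilon>\<^sub>0_def using pos slack by (subst Min_gr_iff) auto
    moreover have "\<epsilon>\<^sub>0 \<le> r i" unfolding \<epsilon>\<^sub>0_def by (intro Min_le) auto
    moreover have le: "\<epsilon>\<^sub>0 \<le> sum r {1..k} - sum w {1..k}" if "k < n" "i \<le> k" "k < j" for k
      unfolding \<epsilon>\<^sub>0_def using that by (intro Min_le) auto
    have "r(i := r i - \<epsilon>, j := r j + \<epsilon>) \<in> admissible n L w"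
      if \<epsilon>: "0 < \<epsilon>" "\<epsilon> \<le> \<epsilon>\<^sub>0" for \<epsilon>
    proof -
      let ?r = "r(i := r i - \<epsilon>, j := r j + \<epsilon>)"
      have eq: "?r = (\<lambda>l. r l + ((if l = j then \<epsilon> else 0) - (if l = i then \<epsilon> else 0)))"
        using ij(3) by auto
      have sum: "sum ?r {1..k}
        = sum r {1..k} + ((if j \<le> k then \<epsilon> else 0) - (if i \<le> k then \<epsilon> else 0))" for k
        unfolding eq using ij by (simp add: sum.distrib sum_subtractf)
      have "sum w {1..k} \<le> sum ?r {1..k}" if "k < n" for k
        using \<epsilon> le[of k] that r unfolding sum admissible_def by force
      moreover have "sum ?r {1..n} = sum w {1..L}"
        unfolding sum using ij r by (simp add: admissible_def)
      moreover have "0 \<le> ?r l" for l using r0[of l] r0[of j] \<epsilon> \<open>\<epsilon>\<^sub>0 \<le> r i\<close> by auto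
      moreover have "?r l = 0" if "l \<notin> {1..n}" for l
        using that ij r by (auto simp: admissible_def)
      ultimately show ?thesis by (auto simp only: admissible_def mem_Collect_eq)
    qed
    ultimately show ?thesis
      unfolding x_def by (intro least_squares_transfer[OF min ij])
  qed
  have "excess n x t = 0 \<or>
      (\<exists>k<n. excess n x t \<le> (\<Sum>i\<in>{k<..n}. max 0 (a i - t)) - sum w {k<..L})" for t
  proof (cases "\<forall>j\<in>{1..n}. x j < t")
    case True
    then show ?thesis by (auto simp: excess_def max_def intro!: sum.neutral)
  next
    case False
    then obtain j0 where j0: "j0 \<in> {1..n}" "t \<le> x j0" by force
    \<comment> \<open>\<open>k\<close> is the last position that carries mass although its
      difference is below \<open>t\<close>, or 0 if there is none. Beyond \<open>k\<close>, a
      difference below \<open>t\<close> means that \<open>r\<close> vanishes there.\<close>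
    define M where "M = insert 0 {k \<in> {1..n}. 0 < r k \<and> x k < t}"
    define k where "k = Max M"
    have finM: "finite M" by (simp add: M_def)
    have kM: "k \<in> M" unfolding k_def using finM by (intro Max_in) (auto simp: M_def)
    have max: "r j = 0" if "j \<in> {1..n}" "k < j" "x j < t" for j
    proof (rule ccontr)
      assume "r j \<noteq> 0"
      then have "j \<in> M" using that r0[of j] by (auto simp: M_def)
      then have "j \<le> k" unfolding k_def by (rule Max_ge[OF finM])
      then show False using that(2) by simp
    qed
    \<comment> \<open>Moving mass from \<open>k\<close> to an earlier position only raises partial
      sums, so it is always allowed.\<close>
    have below_k: "x j < t" if "j \<in> {1..k}" for j
    proof (cases "j = k")
      case True then show ?thesis using kM that by (auto simp: M_def)
    next
      case False
      have "x j \<le> x k" using kM that False by (intro transfer) (auto simp: M_def)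
      then show ?thesis using kM that by (auto simp: M_def)
    qed
    have "k < n" using below_k[of j0] j0 by (intro not_le_imp_less notI) auto
    \<comment> \<open>The first tight index \<open>k'\<close> from \<open>k\<close> on is where mass
      moving right from \<open>k\<close> gets blocked. The index \<open>n\<close> is included to
      make the minimum exist; it is excluded afterwards because all differences up to
      \<open>k'\<close> are below \<open>t\<close> while that at \<open>j0\<close> is not.\<close>
    define tight where "tight l \<longleftrightarrow> k \<le> l \<and> (l = n \<or> sum r {1..l} = sum w {1..l})" for l
    define k' where "k' = (LEAST l. tight l)"
    have "tight n" using \<open>k < n\<close> by (simp add: tight_def)
    then have k': "tight k'" "k' \<le> n" unfolding k'_def by (auto intro: LeastI Least_le)
    have not_tight: "\<not> tight l" if "l < k'" for l using that not_less_Least k'_def by blast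
    have mid: "x j < t" if j: "j \<in> {k<..k'}" for j
    proof (cases "k = 0")
      case True
      \<comment> \<open>Empty partial sums agree, so \<open>k'\<close> is 0 here and the range of
        \<open>j\<close> is empty.\<close>
      then have "tight 0" by (simp add: tight_def)
      then show ?thesis using j True not_tight[of 0] by auto
    next
      case False
      have slack: "sum w {1..l} < sum r {1..l}" if "l < n" "k \<le> l" "l < j" for l
      proof -
        have "sum r {1..l} \<noteq> sum w {1..l}"
          using not_tight[of l] that j by (auto simp: tight_def)
        moreover have "sum w {1..l} \<le> sum r {1..l}" using r that by (simp add: admissible_def)
        ultimately show ?thesis by simp
      qed
      have "x j \<le> x k" using kM False j k' slack by (intro transfer) (auto simp: M_def)
      then show ?thesis using kM False by (auto simp: M_def)
    qed
    have below: "x j < t" if "j \<in> {1..k'}" for j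
      using below_k[of j] mid[of j] that by force
    have "k' < n" using below[of j0] j0 by (intro not_le_imp_less notI) auto
    then have tight': "sum r {1..k'} = sum w {1..k'}" using k' by (simp add: tight_def)
    have kk': "k \<le> k'" using k' by (simp add: tight_def)
    have split: "sum f {1..l} = sum f {1..k'} + sum f {k'<..l}" if "k' \<le> l" for f :: "nat \<Rightarrow> real" and l
    proof -
      have "{1..l} = {1..k'} \<union> {k'<..l}" using that by auto
      then show ?thesis by (simp only:) (rule sum.union_disjoint, auto)
    qed
    have "sum r {k'<..n} = sum w {k'<..L}"
      using split[where f = r and l = n] split[where f = w and l = L] \<open>k' < n\<close> n r tight' by (simp add: admissible_def)
    moreover have "excess n x t = (\<Sum>i\<in>{k'<..n}. max 0 (x i - t))"
      unfolding excess_def using less_imp_le[OF below] \<open>k' < n\<close>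
      by (intro sum.mono_neutral_right) (auto simp: not_less max_def intro: antisym)
    \<comment> \<open>Either the difference is at least \<open>t\<close> and \<open>r i\<close>
      comes out of the positive part unchanged, or it is below \<open>t\<close> and
      \<open>r i = 0\<close>.\<close>
    moreover have "\<dots> = (\<Sum>i\<in>{k'<..n}. max 0 (a i - t) - r i)"
    proof (intro sum.cong refl)
      fix i assume i: "i \<in> {k'<..n}"
      show "max 0 (x i - t) = max 0 (a i - t) - r i"
        using max[of i] r0[of i] i kk' by (cases "x i < t") (auto simp: x_def)
    qed
    ultimately have "excess n x t = (\<Sum>i\<in>{k'<..n}. max 0 (a i - t)) - sum w {k'<..L}"
      by (simp add: sum_subtractf)
    then show ?thesis using \<open>k' < n\<close> by auto
  qed
  then show ?thesis using r that unfolding x_def by blast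
qed

section \<open>Frame operators of minimal difference\<close>

lemma quadratic_form_eigensystem:
  fixes A :: "complex^'d^'d"
  assumes es: "eigensystem A b v"
  shows "Re (cinner (A *v x) x) = (\<Sum>i\<in>{1..CARD('d)}. b i * (cmod (cinner x (v i)))\<^sup>2)"
proof -
  have on: "orthonormal_on {1..CARD('d)} v" using es by (simp add: eigensystem_def)
  have "A *v x = A *v (\<Sum>i\<in>{1..CARD('d)}. cinner x (v i) *s v i)"
    by (subst orthonormal_expansion[OF on]) auto
  also have "\<dots> = (\<Sum>i\<in>{1..CARD('d)}. (cinner x (v i) * complex_of_real (b i)) *s v i)"
    using es by (simp add: matrix_vector_mult_sum matrix_vector_mult_scale eigensystem_def
        vector_smult_assoc)
  finally have "cinner (A *v x) x
      = complex_of_real (\<Sum>i\<in>{1..CARD('d)}. b i * (cmod (cinner x (v i)))\<^sup>2)"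
    by (simp add: cinner_linear complex_norm_square cnj_cinner mult_ac del: of_real_power)
  then show ?thesis by simp
qed

section \<open>Ky Fan's inequality and the lower bounds\<close>

text \<open>The weights \<open>(cmod (cinner (f j) (v i)))\<^sup>2\<close> sum to 1 over
  \<open>i\<close> by Parseval and to at most 1 over \<open>j\<close> by Bessel. Passing to the
  positive part of \<open>b i - t\<close> first makes the second bound applicable.\<close>

lemma rayleigh_sum_le_excess:
  fixes D :: "complex^'d^'d"
  assumes es: "eigensystem D b v" and on: "orthonormal_on J f" and fin: "finite J"
  shows "(\<Sum>j\<in>J. Re (cinner (D *v f j) (f j)) - t) \<le> excess CARD('d) b t"
proof -
  have onv: "orthonormal_on {1..CARD('d)} v" using es by (simp add: eigensystem_def)
  have "Re (cinner (D *v f j) (f j)) - t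
      \<le> (\<Sum>i\<in>{1..CARD('d)}. max 0 (b i - t) * (cmod (cinner (f j) (v i)))\<^sup>2)" if "j \<in> J" for j
  proof -
    have "(\<Sum>i\<in>{1..CARD('d)}. (cmod (cinner (f j) (v i)))\<^sup>2) = 1"
      using parseval[OF onv, of "f j"] orthonormal_on_norm[OF on that] by simp
    then have "Re (cinner (D *v f j) (f j)) - t
        = (\<Sum>i\<in>{1..CARD('d)}. b i * (cmod (cinner (f j) (v i)))\<^sup>2)
          - t * (\<Sum>i\<in>{1..CARD('d)}. (cmod (cinner (f j) (v i)))\<^sup>2)"
      by (simp add: quadratic_form_eigensystem[OF es])
    also have "\<dots> = (\<Sum>i\<in>{1..CARD('d)}. (b i - t) * (cmod (cinner (f j) (v i)))\<^sup>2)"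
      by (simp add: sum_distrib_left sum_subtractf left_diff_distrib)
    also have "\<dots> \<le> (\<Sum>i\<in>{1..CARD('d)}. max 0 (b i - t) * (cmod (cinner (f j) (v i)))\<^sup>2)"
      by (intro sum_mono mult_right_mono) auto
    finally show ?thesis .
  qed
  then have "(\<Sum>j\<in>J. Re (cinner (D *v f j) (f j)) - t)
      \<le> (\<Sum>j\<in>J. \<Sum>i\<in>{1..CARD('d)}. max 0 (b i - t) * (cmod (cinner (f j) (v i)))\<^sup>2)"
    by (rule sum_mono)
  also have "\<dots> = (\<Sum>i\<in>{1..CARD('d)}. max 0 (b i - t) * (\<Sum>j\<in>J. (cmod (cinner (v i) (f j)))\<^sup>2))"
    by (subst sum.swap) (simp add: sum_distrib_left cmod_cinner_commute)
  also have "\<dots> \<le> (\<Sum>i\<in>{1..CARD('d)}. max 0 (b i - t) * 1)"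
  proof (intro sum_mono mult_left_mono)
    fix i assume "i \<in> {1..CARD('d)}"
    then show "(\<Sum>j\<in>J. (cmod (cinner (v i) (f j)))\<^sup>2) \<le> 1"
      using bessel[OF on fin, of "v i"] orthonormal_on_norm[OF onv] by simp
  qed auto
  finally show ?thesis by (simp add: excess_def)
qed

text \<open>By symmetry the excess is an invariant of \<open>D\<close>, independent of the order and
  choice of eigenvectors. Equality in Ky Fan's inequality is reached by the eigenvectors with
  eigenvalue above \<open>t\<close>.\<close>

lemma excess_le_of_eigensystems:
  fixes D :: "complex^'d^'d"
  assumes "eigensystem D b v" "eigensystem D x u"
  shows "excess CARD('d) b t \<le> excess CARD('d) x t"
proof -
  define J where "J = {i \<in> {1..CARD('d)}. t < b i}"
  have on: "orthonormal_on J v"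
    using assms(1) by (auto simp: eigensystem_def J_def intro: orthonormal_on_subset)
  have "excess CARD('d) b t = (\<Sum>i\<in>J. max 0 (b i - t))"
    unfolding excess_def J_def by (intro sum.mono_neutral_right) (auto simp: max_def)
  also have "\<dots> = (\<Sum>i\<in>J. Re (cinner (D *v v i) (v i)) - t)"
  proof (intro sum.cong refl)
    fix i assume i: "i \<in> J"
    then have "D *v v i = complex_of_real (b i) *s v i" using assms(1) by (simp add: eigensystem_def J_def)
    then show "max 0 (b i - t) = Re (cinner (D *v v i) (v i)) - t"
      using orthonormal_onD[OF on i i] i by (simp add: cinner_scale_left J_def)
  qed
  also have "\<dots> \<le> excess CARD('d) x t"
    by (rule rayleigh_sum_le_excess[OF assms(2) on]) (simp add: J_def)
  finally show ?thesis .
qed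

text \<open>Both sides are the trace of \<open>D\<close>.\<close>

lemma rayleigh_sum_full:
  fixes D :: "complex^'d^'d"
  assumes es: "eigensystem D b v" and on: "orthonormal_on J f" and card: "card J = CARD('d)"
  shows "(\<Sum>j\<in>J. Re (cinner (D *v f j) (f j))) = sum b {1..CARD('d)}"
proof -
  have onv: "orthonormal_on {1..CARD('d)} v" using es by (simp add: eigensystem_def)
  have "(\<Sum>j\<in>J. Re (cinner (D *v f j) (f j)))
      = (\<Sum>j\<in>J. \<Sum>i\<in>{1..CARD('d)}. b i * (cmod (cinner (f j) (v i)))\<^sup>2)"
    by (simp add: quadratic_form_eigensystem[OF es])
  also have "\<dots> = (\<Sum>i\<in>{1..CARD('d)}. b i * (\<Sum>j\<in>J. (cmod (cinner (v i) (f j)))\<^sup>2))"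
    by (subst sum.swap) (simp add: sum_distrib_left cmod_cinner_commute)
  also have "\<dots> = sum b {1..CARD('d)}"
    using parseval[OF on card] orthonormal_on_norm[OF onv] by (intro sum.cong) auto
  finally show ?thesis .
qed

lemma sum_eigenvalues_diff_frame_op:
  fixes A :: "complex^'d^'d"
  assumes esA: "eigensystem A a v" and esD: "eigensystem (A - frame_op K G) b u"
    and G: "\<forall>i\<in>{1..K}. (norm (G i))\<^sup>2 = w i"
  shows "sum b {1..CARD('d)} = sum a {1..CARD('d)} - sum w {1..K}"
proof -
  have on: "orthonormal_on {1..CARD('d)} v" using esA by (simp add: eigensystem_def)
  have "sum b {1..CARD('d)} = (\<Sum>j\<in>{1..CARD('d)}. Re (cinner ((A - frame_op K G) *v v j) (v j)))"
    using rayleigh_sum_full[OF esD on] by simp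
  also have "\<dots> = (\<Sum>j\<in>{1..CARD('d)}. Re (cinner (A *v v j) (v j)))
      - (\<Sum>j\<in>{1..CARD('d)}. \<Sum>i\<in>{1..K}. (cmod (cinner (G i) (v j)))\<^sup>2)"
    by (simp add: matrix_vector_mult_diff_rdistrib cinner_diff_left cinner_frame_op sum_subtractf
        cmod_cinner_commute)
  also have "(\<Sum>j\<in>{1..CARD('d)}. Re (cinner (A *v v j) (v j))) = sum a {1..CARD('d)}"
    using rayleigh_sum_full[OF esA on] by simp
  also have "(\<Sum>j\<in>{1..CARD('d)}. \<Sum>i\<in>{1..K}. (cmod (cinner (G i) (v j)))\<^sup>2) = sum w {1..K}"
    using G parseval[OF on] by (subst sum.swap) (auto intro!: sum.cong)
  finally show ?thesis .
qed

text \<open>Courant--Fischer test vectors: \<open>f l\<close> lies in the span of the first \<open>l\<close> eigenvectors and is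
  orthogonal to \<open>k\<close> given vectors and to the preceding test vectors, which are \<open>l - 1\<close>
  conditions in all.\<close>

lemma courant_fischer_vectors:
  fixes v :: "nat \<Rightarrow> complex^'d"
  assumes on: "orthonormal_on {1..n} v" and "k \<le> j" "j \<le> n"
  shows "\<exists>f. orthonormal_on {k<..j} f \<and> (\<forall>l\<in>{k<..j}.
      (\<forall>i\<in>{l<..n}. cinner (f l) (v i) = 0) \<and> (\<forall>i\<in>{1..k}. cinner (f l) (G i) = 0))"
  using assms(2,3)
proof (induction j rule: dec_induct)
  case base
  show ?case by (auto simp: orthonormal_on_def)
next
  case (step j)
  then obtain f where f: "orthonormal_on {k<..j} f"
    and fv: "\<And>l i. l \<in> {k<..j} \<Longrightarrow> i \<in> {l<..n} \<Longrightarrow> cinner (f l) (v i) = 0"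
    and fG: "\<And>l i. l \<in> {k<..j} \<Longrightarrow> i \<in> {1..k} \<Longrightarrow> cinner (f l) (G i) = 0"
    by auto
  \<comment> \<open>The \<open>j\<close> vectors to be avoided: \<open>G\<close> at positions up to
    \<open>k\<close>, the earlier test vectors above. They leave a nonzero choice of the
    \<open>Suc j\<close> coefficients.\<close>
  define z where "z i = (if i \<le> k then G i else f i)" for i
  obtain c where c: "\<exists>i\<in>{1..Suc j}. c i \<noteq> 0"
    "\<forall>l\<in>{1..j}. (\<Sum>i\<in>{1..Suc j}. c i * cinner (v i) (z l)) = 0"
    using nontrivial_solution[of "{1..j}" "{1..Suc j}" "\<lambda>i l. cinner (v i) (z l)"] by auto
  define x where "x = (\<Sum>i\<in>{1..Suc j}. c i *s v i)"
  have on': "orthonormal_on {1..Suc j} v"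
    by (rule orthonormal_on_subset[OF on]) (use step in auto)
  have "x \<noteq> 0"
  proof
    assume "x = 0"
    moreover obtain i where i: "i \<in> {1..Suc j}" "c i \<noteq> 0" using c(1) by blast
    ultimately show False
      using cinner_sum_orthonormal[OF on' finite_atLeastAtMost i(1), of c] by (simp only: x_def[symmetric]) simp
  qed
  have xz: "cinner x (z l) = 0" if "l \<in> {1..j}" for l
    using c(2) that by (simp add: x_def cinner_linear)
  have xv: "cinner x (v i) = 0" if "i \<in> {Suc j<..n}" for i
    unfolding x_def cinner_linear using that
    by (intro sum.neutral ballI) (auto simp: orthonormal_onD[OF on])
  define y where "y = complex_of_real (inverse (norm x)) *s x"
  have y: "norm y = 1" using \<open>x \<noteq> 0\<close>
    unfolding y_def norm_scale_of_real by simp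
  have yx: "cinner y q = 0" if "cinner x q = 0" for q
    using that by (simp add: y_def cinner_scale_left)
  have yf: "cinner y (f l) = 0" if "l \<in> {k<..j}" for l
    using xz[of l] that yx[of "f l"] by (simp add: z_def)
  have fy: "cinner (f l) y = 0" if "l \<in> {k<..j}" for l
    using yf[OF that] by (simp add: cinner_eq_zero_commute)
  have yG: "cinner y (G i) = 0" if "i \<in> {1..k}" for i
    using xz[of i] that yx[of "G i"] step by (simp add: z_def)
  have set: "{k<..Suc j} = insert (Suc j) {k<..j}" using step by auto
  have "orthonormal_on {k<..Suc j} (f(Suc j := y))"
    unfolding set using f y yf fy
    by (auto simp: orthonormal_on_def cinner_self)
  moreover have "\<forall>l\<in>{k<..Suc j}. (\<forall>i\<in>{l<..n}. cinner ((f(Suc j := y)) l) (v i) = 0)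
      \<and> (\<forall>i\<in>{1..k}. cinner ((f(Suc j := y)) l) (G i) = 0)"
    unfolding set using fv fG yG xv yx by auto
  ultimately show ?case by blast
qed

text \<open>Ky Fan's inequality is applied to the test vectors \<open>f l\<close> with
  \<open>a l > t\<close>. As \<open>f l\<close> lies in the span of the first \<open>l\<close>
  eigenvectors, its Rayleigh quotient for \<open>A\<close> is at least \<open>a l\<close>. The
  vectors \<open>G i\<close> with \<open>i \<le> k\<close> are orthogonal to all \<open>f l\<close>,
  and each later one contributes at most its squared norm by Bessel.\<close>

lemma excess_lower_bound:
  fixes A :: "complex^'d^'d"
  assumes esA: "eigensystem A a v" and a: "antimono_on {1..CARD('d)} a"
    and esD: "eigensystem (A - frame_op K G) b u"
    and G: "\<forall>i\<in>{1..K}. (norm (G i))\<^sup>2 = w i" and k: "k \<le> CARD('d)"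
  shows "(\<Sum>i\<in>{k<..CARD('d)}. max 0 (a i - t)) - sum w {k<..K} \<le> excess CARD('d) b t"
proof -
  have on: "orthonormal_on {1..CARD('d)} v" using esA by (simp add: eigensystem_def)
  obtain f where f: "orthonormal_on {k<..CARD('d)} f"
    and fv: "\<And>l i. l \<in> {k<..CARD('d)} \<Longrightarrow> i \<in> {l<..CARD('d)} \<Longrightarrow> cinner (f l) (v i) = 0"
    and fG: "\<And>l i. l \<in> {k<..CARD('d)} \<Longrightarrow> i \<in> {1..k} \<Longrightarrow> cinner (f l) (G i) = 0"
    using courant_fischer_vectors[OF on k order_refl] by blast
  define J where "J = {l \<in> {k<..CARD('d)}. t < a l}"
  have J: "J \<subseteq> {k<..CARD('d)}" "finite J" by (auto simp: J_def)
  have onJ: "orthonormal_on J f" using f J(1) by (rule orthonormal_on_subset)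
  have Af: "a l \<le> Re (cinner (A *v f l) (f l))" if l: "l \<in> J" for l
  proof -
    have "a l = a l * (\<Sum>i\<in>{1..CARD('d)}. (cmod (cinner (f l) (v i)))\<^sup>2)"
      using parseval[OF on, of "f l"] orthonormal_on_norm[OF onJ l] by simp
    also have "\<dots> = (\<Sum>i\<in>{1..CARD('d)}. a l * (cmod (cinner (f l) (v i)))\<^sup>2)"
      by (rule sum_distrib_left)
    also have "\<dots> \<le> (\<Sum>i\<in>{1..CARD('d)}. a i * (cmod (cinner (f l) (v i)))\<^sup>2)"
    proof (intro sum_mono)
      fix i assume i: "i \<in> {1..CARD('d)}"
      show "a l * (cmod (cinner (f l) (v i)))\<^sup>2 \<le> a i * (cmod (cinner (f l) (v i)))\<^sup>2"
      proof (cases "i \<le> l")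
        case True
        then have "a l \<le> a i" using a i l J(1) by (auto simp: monotone_on_def)
        then show ?thesis by (rule mult_right_mono) simp
      next
        case False
        then have "cinner (f l) (v i) = 0" using i l J(1) by (intro fv) auto
        then show ?thesis by simp
      qed
    qed
    also have "\<dots> = Re (cinner (A *v f l) (f l))" by (simp add: quadratic_form_eigensystem[OF esA])
    finally show ?thesis .
  qed
  have Sf: "(\<Sum>l\<in>J. Re (cinner (frame_op K G *v f l) (f l))) \<le> sum w {k<..K}"
  proof -
    have "(\<Sum>l\<in>J. Re (cinner (frame_op K G *v f l) (f l)))
        = (\<Sum>l\<in>J. \<Sum>i\<in>{1..K}. (cmod (cinner (f l) (G i)))\<^sup>2)"
      by (simp add: cinner_frame_op)
    also have "\<dots> = (\<Sum>l\<in>J. \<Sum>i\<in>{k<..K}. (cmod (cinner (f l) (G i)))\<^sup>2)"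
      using fG J(1) by (intro sum.cong sum.mono_neutral_right) (auto simp: not_less)
    also have "\<dots> = (\<Sum>i\<in>{k<..K}. \<Sum>l\<in>J. (cmod (cinner (G i) (f l)))\<^sup>2)"
      by (subst sum.swap) (simp add: cmod_cinner_commute)
    also have "\<dots> \<le> (\<Sum>i\<in>{k<..K}. (norm (G i))\<^sup>2)"
      by (intro sum_mono bessel[OF onJ J(2)])
    also have "\<dots> = sum w {k<..K}" using G by (intro sum.cong) auto
    finally show ?thesis .
  qed
  have "(\<Sum>i\<in>{k<..CARD('d)}. max 0 (a i - t)) = (\<Sum>i\<in>J. max 0 (a i - t))"
    unfolding J_def by (intro sum.mono_neutral_right) (auto simp: max_def)
  also have "\<dots> = (\<Sum>i\<in>J. a i - t)" by (intro sum.cong) (auto simp: J_def)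
  also have "\<dots> \<le> (\<Sum>i\<in>J. Re (cinner (A *v f i) (f i)) - t)"
    using Af by (intro sum_mono) auto
  finally have "(\<Sum>i\<in>{k<..CARD('d)}. max 0 (a i - t)) - sum w {k<..K}
      \<le> (\<Sum>i\<in>J. Re (cinner (A *v f i) (f i)) - t)
        - (\<Sum>l\<in>J. Re (cinner (frame_op K G *v f l) (f l)))"
    using Sf by linarith
  also have "\<dots> = (\<Sum>i\<in>J. Re (cinner ((A - frame_op K G) *v f i) (f i)) - t)"
    by (simp add: matrix_vector_mult_diff_rdistrib cinner_diff_left sum_subtractf)
  also have "\<dots> \<le> excess CARD('d) b t" by (rule rayleigh_sum_le_excess[OF esD onJ J(2)])
  finally show ?thesis .
qed

section \<open>Prescribing squared norms by plane rotations\<close>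

text \<open>A rotation of the pair preserves the sum of the two rank-one operators, and a quarter
  turn takes the first vector from \<open>x\<close> to \<open>y\<close>. By the intermediate value
  theorem its squared norm passes through the required value, and the other follows since the sum of
  squared norms is preserved.\<close>

lemma rotate_pair:
  fixes x y :: "complex^'d"
  assumes "0 < \<delta>" "\<delta> < (norm x)\<^sup>2 - (norm y)\<^sup>2"
  obtains x' y' where "(norm x')\<^sup>2 = (norm x)\<^sup>2 - \<delta>" "(norm y')\<^sup>2 = (norm y)\<^sup>2 + \<delta>"
    "rank_one x' + rank_one y' = rank_one x + rank_one y"
proof -
  define p where "p \<theta> = cos \<theta> *\<^sub>R x + sin \<theta> *\<^sub>R y" for \<theta>
  define q where "q \<theta> = cos \<theta> *\<^sub>R y - sin \<theta> *\<^sub>R x" for \<theta>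
  have "\<exists>\<theta>. 0 \<le> \<theta> \<and> \<theta> \<le> pi / 2 \<and> (norm (p \<theta>))\<^sup>2 = (norm x)\<^sup>2 - \<delta>"
    using assms by (intro IVT2') (auto simp: p_def intro!: continuous_intros)
  then obtain \<theta> where \<theta>: "(norm (p \<theta>))\<^sup>2 = (norm x)\<^sup>2 - \<delta>" by blast
  have cs: "cos \<theta> * cos \<theta> + sin \<theta> * sin \<theta> = 1"
    using sin_cos_squared_add[of \<theta>] by (simp add: power2_eq_square)
  have "(norm (c *\<^sub>R x + s *\<^sub>R y))\<^sup>2 + (norm (c *\<^sub>R y - s *\<^sub>R x))\<^sup>2
      = (c * c + s * s) * ((norm x)\<^sup>2 + (norm y)\<^sup>2)" for c s
    by (simp add: power2_norm_eq_inner inner_simps inner_commute algebra_simps)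
  from this[of "cos \<theta>" "sin \<theta>"] have "(norm (q \<theta>))\<^sup>2 = (norm y)\<^sup>2 + \<delta>"
    using \<theta> cs by (simp add: p_def q_def)
  moreover have "rank_one (p \<theta>) + rank_one (q \<theta>) = rank_one x + rank_one y"
  proof -
    define c s where "c = complex_of_real (cos \<theta>)" and "s = complex_of_real (sin \<theta>)"
    have cs': "c * c + s * s = 1"
      unfolding c_def s_def using cs by (metis of_real_add of_real_mult of_real_1)
    have rot: "(c * a + s * b) * (c * a' + s * b') + (c * b - s * a) * (c * b' - s * a')
        = a * a' + b * b'" for a a' b b'
      using cs' by algebra
    have "p \<theta> $ i = c * x $ i + s * y $ i" "q \<theta> $ i = c * y $ i - s * x $ i"
      "cnj (p \<theta> $ i) = c * cnj (x $ i) + s * cnj (y $ i)"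
      "cnj (q \<theta> $ i) = c * cnj (y $ i) - s * cnj (x $ i)" for i
      by (simp_all add: p_def q_def c_def s_def complex_eq_iff)
    then have "p \<theta> $ i * cnj (p \<theta> $ j) + q \<theta> $ i * cnj (q \<theta> $ j)
        = x $ i * cnj (x $ j) + y $ i * cnj (y $ j)" for i j
      by (simp only: rot)
    then show ?thesis by (simp add: rank_one_def vec_eq_iff)
  qed
  ultimately show ?thesis using \<theta> that by blast
qed

text \<open>As a property of \<open>\<mu>\<close> for fixed \<open>S\<close>, this is the invariant
  carried along the transfer chains.\<close>

definition realizable :: "'i set \<Rightarrow> complex^'d^'d \<Rightarrow> ('i \<Rightarrow> real) \<Rightarrow> bool" where
  "realizable I S \<mu> \<longleftrightarrow> (\<exists>h. (\<forall>i\<in>I. (norm (h i))\<^sup>2 = \<mu> i) \<and> (\<Sum>i\<in>I. rank_one (h i)) = S)"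

lemma realizable_transfer:
  assumes fin: "finite I" and "realizable I S \<mu>" and ij: "i \<in> I" "j \<in> I" "i \<noteq> j"
    and \<delta>: "0 < \<delta>" "\<delta> < \<mu> i - \<mu> j"
  shows "realizable I S (\<mu>(i := \<mu> i - \<delta>, j := \<mu> j + \<delta>))"
proof -
  obtain h where h: "\<forall>i\<in>I. (norm (h i))\<^sup>2 = \<mu> i" "(\<Sum>i\<in>I. rank_one (h i)) = S"
    using assms(2) by (auto simp: realizable_def)
  obtain x y where xy: "(norm x)\<^sup>2 = \<mu> i - \<delta>" "(norm y)\<^sup>2 = \<mu> j + \<delta>"
    "rank_one x + rank_one y = rank_one (h i) + rank_one (h j)"
    using rotate_pair[of \<delta> "h i" "h j"] h(1) ij \<delta> by metis
  define h' where "h' = h(i := x, j := y)"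
  have split: "(\<Sum>l\<in>I. rank_one (k l)) = rank_one (k i) + rank_one (k j) + (\<Sum>l\<in>I - {i} - {j}. rank_one (k l))"
    for k :: "'a \<Rightarrow> complex^'b"
    using fin ij by (simp add: sum.remove[of I i] sum.remove[of "I - {i}" j] add.assoc)
  have "(\<Sum>l\<in>I. rank_one (h' l)) = S"
  proof -
    have "(\<Sum>l\<in>I - {i} - {j}. rank_one (h' l)) = (\<Sum>l\<in>I - {i} - {j}. rank_one (h l))"
      by (intro sum.cong) (auto simp: h'_def)
    then have "(\<Sum>l\<in>I. rank_one (h' l)) = (\<Sum>l\<in>I. rank_one (h l))"
      unfolding split[of h'] split[of h] using xy(3) ij by (simp add: h'_def)
    then show ?thesis using h(2) by simp
  qed
  then show ?thesis
    unfolding realizable_def using h(1) xy ij by (intro exI[of _ h']) (auto simp: h'_def)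
qed

text \<open>Horn's direction of the Schur--Horn theorem: the eigenvalues \<open>r\<close> majorise the prescribed
  squared norms \<open>w\<close>.\<close>

lemma realizable_of_admissible:
  fixes v :: "nat \<Rightarrow> complex^'d"
  assumes on: "orthonormal_on {1..n} v" and nL: "n \<le> L"
    and w: "antimono_on {1..L} w" "\<And>i. 0 \<le> w i" and r: "r \<in> admissible n L w"
  obtains h where "\<forall>i\<in>{1..L}. (norm (h i))\<^sup>2 = w i"
    "\<And>j. j \<in> {1..n} \<Longrightarrow> (\<Sum>i\<in>{1..L}. rank_one (h i)) *v v j = complex_of_real (r j) *s v j"
proof -
  \<comment> \<open>Start of the chain: an orthogonal family with squared norms \<open>r\<close>. It
    vanishes beyond \<open>n\<close>, whatever \<open>v\<close> is there.\<close>
  define e where "e i = complex_of_real (sqrt (r i)) *s v i" for i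
  define S where "S = (\<Sum>i\<in>{1..L}. rank_one (e i))"
  have r0: "0 \<le> r i" for i using r by (simp add: admissible_def)
  have rout: "r i = 0" if "i \<notin> {1..n}" for i using r that by (simp add: admissible_def)
  have "(norm (e i))\<^sup>2 = r i" for i
    using r0[of i] rout[of i] orthonormal_on_norm[OF on, of i]
    by (cases "i \<in> {1..n}") (auto simp: e_def norm_scale_of_real)
  then have Q: "realizable {1..L} S r"
    unfolding realizable_def by (intro exI[of _ e]) (auto simp: S_def)
  have tail: "sum r {1..k} = sum r {1..n}" if "n \<le> k" for k
    using that rout by (intro sum.mono_neutral_right) auto
  have le: "sum w {1..k} \<le> sum r {1..k}" if "k \<le> L" for k
  proof (cases "k < n")
    case True
    then show ?thesis using r by (simp add: admissible_def)
  next
    case False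
    have "sum w {1..k} \<le> sum w {1..L}" using that w(2) by (intro sum_mono2) auto
    then show ?thesis using r False tail[of k] by (simp add: admissible_def)
  qed
  have "\<exists>\<mu>'. realizable {1..L} S \<mu>' \<and> (\<forall>i\<in>{1..L}. \<mu>' i = w i)"
  proof (rule transfer_chain[where Q = "realizable {1..L} S", OF _ w(1) Q le])
    show "sum w {1..L} = sum r {1..L}" using r tail[OF nL] by (simp add: admissible_def)
  qed (auto intro: realizable_transfer)
  then obtain h where h: "\<forall>i\<in>{1..L}. (norm (h i))\<^sup>2 = w i" "(\<Sum>i\<in>{1..L}. rank_one (h i)) = S"
    by (auto simp: realizable_def)
  have "S *v v j = complex_of_real (r j) *s v j" if j: "j \<in> {1..n}" for j
  proof -
    have "rank_one (e i) *v v j = (if i = j then complex_of_real (r j) *s v j else 0)" for i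
    proof (cases "i \<in> {1..n}")
      case True
      then show ?thesis using orthonormal_onD[OF on j True] r0[of j]
        by (simp add: rank_one_mult e_def cinner_scale_right vector_smult_assoc
            of_real_mult[symmetric] del: of_real_mult)
    next
      case False
      then show ?thesis using rout[of i] j by (auto simp: rank_one_mult e_def)
    qed
    then have "S *v v j = (\<Sum>i\<in>{1..L}. if i = j then complex_of_real (r j) *s v j else 0)"
      by (simp add: S_def matrix_vector_mult_sum_left)
    then show ?thesis using j nL by simp
  qed
  then show ?thesis using h that by metis
qed

theorem majorization_optimal_family:
  fixes A :: "complex^'d^'d"
  assumes herm: "adj A = A"
    and w: "antimono_on {1..K} w" "\<forall>i\<in>{1..K}. 0 \<le> w i"
  obtains G0 where "G0 \<in> vec_families K w"
    "\<And>G b0 u0 b u t. G \<in> vec_families K w \<Longrightarrow> eigensystem (A - frame_op K G0) b0 u0 \<Longrightarrow>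
      eigensystem (A - frame_op K G) b u \<Longrightarrow>
      excess CARD('d) b0 t \<le> excess CARD('d) b t \<and> sum b0 {1..CARD('d)} = sum b {1..CARD('d)}"
proof -
  obtain a v where esA: "eigensystem A a v" and a: "antimono_on {1..CARD('d)} a"
    using hermitian_eigensystem[OF herm] .
  have on: "orthonormal_on {1..CARD('d)} v" using esA by (simp add: eigensystem_def)
  \<comment> \<open>With fewer vectors than dimensions the weights are padded by zeros. They keep
    the sequence decreasing, and zero weights force zero vectors, so the frame operator does not
    change.\<close>
  define L where "L = max CARD('d) K"
  define w' where "w' i = (if i \<in> {1..K} then w i else 0)" for i
  have L: "CARD('d) \<le> L" "K \<le> L" by (auto simp: L_def)
  have w'0: "0 \<le> w' i" for i using w(2) by (simp add: w'_def)
  have w': "antimono_on {1..L} w'"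
    using w by (auto simp: w'_def monotone_on_def)
  have "1 \<le> CARD('d)" by (simp add: Suc_le_eq)
  then obtain r where r: "r \<in> admissible CARD('d) L w'"
    and opt: "\<And>t. excess CARD('d) (\<lambda>i. a i - r i) t = 0 \<or>
      (\<exists>k<CARD('d). excess CARD('d) (\<lambda>i. a i - r i) t
        \<le> (\<Sum>i\<in>{k<..CARD('d)}. max 0 (a i - t)) - sum w' {k<..L})"
    using optimal_spectrum[of "CARD('d)" L w' a] L w'0 by blast
  obtain h where h: "\<forall>i\<in>{1..L}. (norm (h i))\<^sup>2 = w' i"
    and Sv: "\<And>j. j \<in> {1..CARD('d)} \<Longrightarrow>
      (\<Sum>i\<in>{1..L}. rank_one (h i)) *v v j = complex_of_real (r j) *s v j"
    using realizable_of_admissible[OF on L(1) w' w'0 r] by blast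
  have hK: "h \<in> vec_families K w"
    using h L by (auto simp: vec_families_def w'_def)
  have "h i = 0" if "i \<in> {1..L} - {1..K}" for i using bspec[OF h, of i] that by (simp add: w'_def)
  then have S: "frame_op K h = (\<Sum>i\<in>{1..L}. rank_one (h i))"
    unfolding frame_op_def using L by (intro sum.mono_neutral_left) (auto simp: rank_one_def vec_eq_iff)
  have esD: "eigensystem (A - frame_op K h) (\<lambda>i. a i - r i) v"
    using esA Sv unfolding S eigensystem_def
    by (auto simp: matrix_vector_mult_diff_rdistrib vector_ssub_ldistrib of_real_diff vector_sub_rdistrib)
  show ?thesis
  proof (rule that[OF hK])
    fix G b0 u0 b u t
    assume G: "G \<in> vec_families K w" and es0: "eigensystem (A - frame_op K h) b0 u0"
      and es: "eigensystem (A - frame_op K G) b u"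
    have Gw: "\<forall>i\<in>{1..K}. (norm (G i))\<^sup>2 = w i" and hw: "\<forall>i\<in>{1..K}. (norm (h i))\<^sup>2 = w i"
      using G hK by (auto simp: vec_families_def)
    have "excess CARD('d) b0 t \<le> excess CARD('d) (\<lambda>i. a i - r i) t"
      by (rule excess_le_of_eigensystems[OF es0 esD])
    also have "\<dots> \<le> excess CARD('d) b t"
      using opt[of t]
    proof
      assume "excess CARD('d) (\<lambda>i. a i - r i) t = 0"
      then show ?thesis by (simp add: excess_def sum_nonneg)
    next
      assume "\<exists>k<CARD('d). excess CARD('d) (\<lambda>i. a i - r i) t
        \<le> (\<Sum>i\<in>{k<..CARD('d)}. max 0 (a i - t)) - sum w' {k<..L}"
      then obtain k where k: "k < CARD('d)" "excess CARD('d) (\<lambda>i. a i - r i) t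
        \<le> (\<Sum>i\<in>{k<..CARD('d)}. max 0 (a i - t)) - sum w' {k<..L}" by blast
      have "sum w' {k<..L} = sum w {k<..K}"
        using L by (subst sum.mono_neutral_right[of _ "{k<..K}"]) (auto simp: w'_def intro!: sum.cong)
      then show ?thesis
        using excess_lower_bound[OF esA a es Gw, of k t] k by simp
    qed
    finally show "excess CARD('d) b0 t \<le> excess CARD('d) b t \<and>
        sum b0 {1..CARD('d)} = sum b {1..CARD('d)}"
      using sum_eigenvalues_diff_frame_op[OF esA es0 hw] sum_eigenvalues_diff_frame_op[OF esA es Gw]
      by simp
  qed
qed

section \<open>Unitarily invariant norms\<close>

lemma adj_mult: "adj (A ** B) = adj B ** adj A"
  by (simp add: adj_def vec_eq_iff map_matrix_def transpose_def matrix_matrix_mult_def mult.commute)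

lemma unitary_adj: "unitary U \<Longrightarrow> unitary (adj U)"
  by (simp add: unitary_def)

lemma unitary_mult:
  assumes "unitary U" "unitary V"
  shows "unitary (U ** V)"
proof -
  have "adj V ** (adj U ** U) ** V = mat 1" "U ** (V ** adj V) ** adj U = mat 1"
    using assms by (simp_all add: unitary_def)
  then show ?thesis by (simp add: unitary_def adj_mult matrix_mul_assoc)
qed

lemma unitaryI:
  assumes "adj U ** U = mat 1"
  shows "unitary U"
  using assms matrix_left_right_inverse[of "adj U" U] by (simp add: unitary_def)

lemma unitary_conj_cancel:
  assumes "unitary V"
  shows "V ** (adj V ** S ** V) ** adj V = S"
proof -
  have "V ** (adj V ** S ** V) ** adj V = (V ** adj V) ** S ** (V ** adj V)"
    by (simp add: matrix_mul_assoc)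
  then show ?thesis using assms by (simp add: unitary_def)
qed

lemma unitary_conj_diff:
  "V ** (A - B) ** adj V = V ** A ** adj V - V ** B ** (adj V :: complex^'d^'d)"
  by (simp add: matrix_eq matrix_vector_mul_assoc[symmetric] matrix_vector_mult_diff_distrib
      matrix_vector_mult_diff_rdistrib)

lemma norm_unitary_mult:
  assumes "unitary V"
  shows "norm (V *v x) = norm x"
proof -
  have "cinner (V *v x) (V *v x) = cinner x x"
    using assms by (simp add: cinner_adj matrix_vector_mul_assoc unitary_def)
  then have "(norm (V *v x))\<^sup>2 = (norm x)\<^sup>2"
    unfolding cinner_self by (simp only: of_real_eq_iff)
  then show ?thesis by simp
qed

lemma rank_one_unitary_mult: "rank_one (V *v g) = V ** rank_one g ** adj V"
proof -
  have "rank_one (V *v g) *v x = (V ** rank_one g ** adj V) *v x" for x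
    using cinner_adj[of "adj V" x g]
    by (simp add: rank_one_mult matrix_vector_mul_assoc[symmetric] matrix_vector_mult_scale)
  then show ?thesis by (simp add: matrix_eq)
qed

lemma frame_op_unitary_mult: "frame_op K (\<lambda>i. V *v G i) = V ** frame_op K G ** adj V"
proof -
  have "frame_op K (\<lambda>i. V *v G i) *v x = (V ** frame_op K G ** adj V) *v x" for x
    by (simp add: frame_op_def rank_one_unitary_mult matrix_vector_mult_sum_left
        matrix_vector_mul_assoc[symmetric] matrix_vector_mult_sum)
  then show ?thesis by (simp add: matrix_eq)
qed

lemma vec_families_unitary_mult:
  "unitary V \<Longrightarrow> G \<in> vec_families K w \<Longrightarrow> (\<lambda>i. V *v G i) \<in> vec_families K w"
  by (simp add: vec_families_def norm_unitary_mult)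

text \<open>The bijection \<open>e\<close> translates the numbering of eigenvectors into the matrix
  index type; the columns of \<open>U\<close> are the eigenvectors.\<close>

lemma eigensystem_diagonalization:
  fixes A :: "complex^'d^'d"
  assumes es: "eigensystem A b v" and e: "bij_betw e (UNIV::'d set) {1..CARD('d)}"
  obtains U where "unitary U" "A = U ** diag_real (\<chi> i. b (e i)) ** adj U"
proof -
  have on: "orthonormal_on {1..CARD('d)} v" using es by (simp add: eigensystem_def)
  have e_in: "e i \<in> {1..CARD('d)}" for i using e by (auto simp: bij_betw_def)
  have e_inj: "e i = e j \<longleftrightarrow> i = j" for i j using e by (auto simp: bij_betw_def inj_on_def)
  define U where "U = (\<chi> r c. v (e c) $ r)"
  have "(adj U ** U) $ i $ j = cinner (v (e j)) (v (e i))" for i j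
    by (simp add: adj_def map_matrix_def transpose_def matrix_matrix_mult_def U_def cinner_def mult.commute)
  then have "adj U ** U = mat 1"
    using orthonormal_onD[OF on e_in e_in] by (simp add: vec_eq_iff mat_def e_inj eq_commute)
  then have U: "unitary U" by (rule unitaryI)
  have "A ** U = U ** diag_real (\<chi> i. b (e i))"
  proof -
    have "(A ** U) $ r $ c = (U ** diag_real (\<chi> i. b (e i))) $ r $ c" for r c
    proof -
      have "(A ** U) $ r $ c = (A *v v (e c)) $ r"
        by (simp add: matrix_matrix_mult_def matrix_vector_mult_def U_def)
      also have "\<dots> = complex_of_real (b (e c)) * v (e c) $ r"
        using es e_in[of c] by (simp add: eigensystem_def)
      also have "\<dots> = (U ** diag_real (\<chi> i. b (e i))) $ r $ c"
        by (simp add: matrix_matrix_mult_def diag_real_def diag_def U_def if_distrib cong: if_cong)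
      finally show ?thesis .
    qed
    then show ?thesis by (simp add: vec_eq_iff)
  qed
  then have "U ** diag_real (\<chi> i. b (e i)) ** adj U = A ** (U ** adj U)"
    by (simp add: matrix_mul_assoc)
  then show ?thesis using U that by (simp add: unitary_def)
qed

lemma diag_permute:
  fixes x :: "complex^'d"
  assumes "inj \<pi>"
  obtains P where "unitary P" "diag (\<chi> i. x $ \<pi> i) = P ** diag x ** adj P"
proof -
  have bij: "bij \<pi>" using assms by (simp add: finite_UNIV_inj_surj bij_def)
  define P :: "complex^'d^'d" where "P = (\<chi> i j. if j = \<pi> i then 1 else 0)"
  have *: "P ** diag y ** adj P = diag (\<chi> i. y $ \<pi> i)" for y
  proof -
    have 1: "(P ** diag y) $ i $ j = (if j = \<pi> i then y $ \<pi> i else 0)" for i j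
    proof -
      have "(P ** diag y) $ i $ j = (\<Sum>k\<in>UNIV. if k = \<pi> i then (if k = j then y $ k else 0) else 0)"
        unfolding matrix_matrix_mult_def vec_lambda_beta
        by (intro sum.cong) (auto simp: P_def diag_def)
      then show ?thesis by simp
    qed
    have "(P ** diag y ** adj P) $ i $ k = diag (\<chi> i. y $ \<pi> i) $ i $ k" for i k
    proof -
      have "(P ** diag y ** adj P) $ i $ k = (\<Sum>j\<in>UNIV. (P ** diag y) $ i $ j * adj P $ j $ k)"
        by (simp add: matrix_matrix_mult_def[of "P ** diag y"])
      also have "\<dots> = (\<Sum>j\<in>UNIV. if j = \<pi> i then (if j = \<pi> k then y $ \<pi> i else 0) else 0)"
        unfolding 1 by (intro sum.cong) (auto simp: adj_def map_matrix_def transpose_def P_def)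
      also have "\<dots> = diag (\<chi> i. y $ \<pi> i) $ i $ k"
        using assms by (auto simp: diag_def dest: injD)
      finally show ?thesis .
    qed
    then show ?thesis by (simp add: vec_eq_iff)
  qed
  \<comment> \<open>The all-ones vector turns the conjugation formula into unitarity of
    \<open>P\<close>.\<close>
  have "diag (\<chi> i. 1) = (mat 1 :: complex^'d^'d)"
    by (simp add: diag_def mat_def vec_eq_iff)
  then have "P ** adj P = mat 1" using *[of "\<chi> i. 1"] by simp
  then have "unitary P" using matrix_left_right_inverse[of P "adj P"] by (simp add: unitary_def)
  then show ?thesis using *[of x] that by metis
qed

lemma spectrum_list_diagonalization:
  assumes "unitary U" and A: "A = U ** diag_real l ** adj U"
  shows "spectrum_list A l"
  unfolding spectrum_list_def
proof
  fix z
  have mat_scale: "mat z *v x = z *s x" for x :: "complex^'a"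
    by (simp add: vec_eq_iff matrix_vector_mult_def mat_def mult_delta_left)
  have "U ** mat z ** adj U = mat z ** (U ** adj U)"
    by (simp add: matrix_eq matrix_vector_mul_assoc[symmetric] mat_scale matrix_vector_mult_scale)
  then have "mat z - A = U ** (mat z - diag_real l) ** adj U"
    using assms by (simp add: unitary_conj_diff unitary_def)
  then have "det (mat z - A) = det U * det (adj U) * det (mat z - diag_real l)"
    by (simp add: det_mul)
  also have "det U * det (adj U) = 1"
    using assms(1) by (simp add: det_mul[symmetric] unitary_def)
  also have "det (mat z - diag_real l) = (\<Prod>i\<in>UNIV. z - complex_of_real (l $ i))"
    by (subst det_diagonal) (auto simp: mat_def diag_real_def diag_def)
  finally show "det (mat z - A) = (\<Prod>i\<in>UNIV. z - complex_of_real (l $ i))" by simp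
qed

text \<open>Both lists give the multiset of roots of one polynomial, since the two products agree at
  every complex number.\<close>

lemma spectrum_list_permutation:
  fixes A :: "complex^'d^'d"
  assumes "spectrum_list A l" "spectrum_list A l'"
  obtains \<pi> where "inj \<pi>" "\<And>i. l $ i = l' $ \<pi> i"
proof -
  define p where "p k = (\<Prod>i\<in>(UNIV::'d set). [:- complex_of_real (k $ i), 1:])" for k
  have roots: "proots (p k) = image_mset (\<lambda>i. complex_of_real (k $ i)) (mset_set UNIV)" for k :: "real^'d"
  proof -
    have "proots (p k) = (\<Sum>i\<in>(UNIV::'d set). proots [:- complex_of_real (k $ i), 1:])"
      unfolding p_def by (rule proots_prod) simp
    also have "\<dots> = (\<Sum>i\<in>UNIV. {#complex_of_real (k $ i)#})"
      by simp
    also have "\<dots> = image_mset (\<lambda>i. complex_of_real (k $ i)) (mset_set UNIV)"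
      by (simp add: sum_unfold_sum_mset)
    finally show ?thesis .
  qed
  have "poly (p l) z = poly (p l') z" for z
    using assms by (simp add: p_def poly_prod spectrum_list_def)
  then have "p l = p l'" by (simp add: poly_eq_poly_eq_iff[symmetric] fun_eq_iff)
  then have "image_mset (\<lambda>i. complex_of_real (l $ i)) (mset_set UNIV)
      = image_mset (\<lambda>i. complex_of_real (l' $ i)) (mset_set UNIV)"
    unfolding roots[symmetric] by simp
  from image_mset_eq_implies_permutes[OF finite this] obtain \<pi> where "\<pi> permutes UNIV"
    "\<forall>i. complex_of_real (l $ i) = complex_of_real (l' $ \<pi> i)" by auto
  then show ?thesis using that[of \<pi>] by (simp add: permutes_inj)
qed

lemma bij_betw_UNIV_nat:
  obtains e where "bij_betw e (UNIV::'d::finite set) {1..CARD('d)}"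
  using ex_bij_betw_finite_nat[of "UNIV::'d set"] bij_betw_trans[of _ _ "{0..<CARD('d)}" Suc "{1..CARD('d)}"]
  by (metis bij_betw_iff_card finite finite_atLeastAtMost card_atLeastAtMost diff_Suc_1)

theorem hermitian_spectrum_list_exists:
  fixes A :: "complex^'d^'d"
  assumes "adj A = A"
  shows "\<exists>l. spectrum_list A l"
proof -
  obtain b v where es: "eigensystem A b v" using hermitian_eigensystem[OF assms] by blast
  obtain e where e: "bij_betw e (UNIV::'d set) {1..CARD('d)}" by (rule bij_betw_UNIV_nat)
  obtain U where "unitary U" "A = U ** diag_real (\<chi> i. b (e i)) ** adj U"
    using eigensystem_diagonalization[OF es e] .
  then show ?thesis using spectrum_list_diagonalization by blast
qed

text \<open>The list \<open>l\<close> comes in an arbitrary order; the permutation from the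
  eigenvalue order to it is absorbed into the unitary matrix.\<close>

theorem hermitian_spectrum_list_diagonalization:
  fixes A :: "complex^'d^'d"
  assumes "adj A = A" and l: "spectrum_list A l"
  obtains V where "unitary V" "A = V ** diag_real l ** adj V"
proof -
  obtain b v where es: "eigensystem A b v" using hermitian_eigensystem[OF assms(1)] by blast
  obtain e where e: "bij_betw e (UNIV::'d set) {1..CARD('d)}" by (rule bij_betw_UNIV_nat)
  define l' where "l' = (\<chi> i. b (e i))"
  obtain U where U: "unitary U" "A = U ** diag_real l' ** adj U"
    unfolding l'_def using eigensystem_diagonalization[OF es e] .
  obtain \<pi> where \<pi>: "inj \<pi>" "\<And>i. l' $ i = l $ \<pi> i"
    using spectrum_list_permutation[OF spectrum_list_diagonalization[OF U] l] by blast
  obtain P where P: "unitary P"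
    "diag (\<chi> i. (\<chi> i. complex_of_real (l $ i)) $ \<pi> i) = P ** diag_real l ** adj P"
    unfolding diag_real_def using diag_permute[OF \<pi>(1)] by blast
  have "diag_real l' = P ** diag_real l ** adj P"
    unfolding P(2)[symmetric] by (simp add: diag_real_def \<pi>(2))
  then have "A = (U ** P) ** diag_real l ** adj (U ** P)"
    unfolding U(2) by (simp add: adj_mult matrix_mul_assoc)
  then show ?thesis using unitary_mult[OF U(1) P(1)] that by blast
qed

section \<open>Strict monotonicity of norms under majorisation\<close>

lemma unitarily_invariant_norm_conj:
  assumes "unitarily_invariant_norm N" "unitary V"
  shows "N (V ** B ** adj V) = N B"
  using assms by (simp add: unitarily_invariant_norm_def unitary_adj)

text \<open>Strict convexity is given on the unit sphere only; the common norm of \<open>x\<close>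
  and \<open>y\<close> is positive because they differ, so one can rescale.\<close>

lemma strictly_convex_vec_norm_combination:
  fixes t :: real
  assumes p: "strictly_convex_vec_norm p" and eq: "p x = p y" and "x \<noteq> y" and t: "0 < t" "t < 1"
  shows "p (t *\<^sub>R x + (1 - t) *\<^sub>R y) < p x"
proof -
  have zero: "p z = 0 \<longleftrightarrow> z = 0" and scale: "p (c *s z) = cmod c * p z"
    and tri: "p (z + z') \<le> p z + p z'" for z z' c
    using p by (auto simp: strictly_convex_vec_norm_def vec_norm_def)
  have "p (x + (-1) *s x) \<le> p x + p x" using tri[of x "(-1) *s x"] scale[of "-1" x] by simp
  moreover have "x + (-1) *s x = 0" by (simp add: vec_eq_iff)
  ultimately have "0 \<le> p x" using zero[of 0] by simp
  moreover have "p x \<noteq> 0" using zero[of x] zero[of y] eq \<open>x \<noteq> y\<close> by auto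
  ultimately have pos: "0 < p x" by simp
  define c where "c = complex_of_real (inverse (p x))"
  have c: "cmod c * p x = 1" "c \<noteq> 0" using pos by (auto simp: c_def norm_inverse)
  have "p (t *\<^sub>R (c *s x) + (1 - t) *\<^sub>R (c *s y)) < 1"
    using p c eq \<open>x \<noteq> y\<close> t by (simp add: strictly_convex_vec_norm_def scale)
  moreover have "t *\<^sub>R (c *s x) + (1 - t) *\<^sub>R (c *s y) = c *s (t *\<^sub>R x + (1 - t) *\<^sub>R y)"
    by (simp add: vec_eq_iff algebra_simps)
  ultimately have "p (c *s (t *\<^sub>R x + (1 - t) *\<^sub>R y)) < 1" by (simp only:)
  then have "cmod c * p (t *\<^sub>R x + (1 - t) *\<^sub>R y) < cmod c * p x"
    unfolding c(1) scale .
  then show ?thesis using c(2) by simp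
qed

text \<open>The vector after the transfer is a proper convex combination of the old one and its
  transposition at \<open>i\<close> and \<open>j\<close>. These two are distinct, and unitary
  invariance gives them the same norm.\<close>

lemma norm_strict_transfer:
  fixes N :: "complex^'d^'d \<Rightarrow> real"
  assumes N: "strictly_convex_ui_norm N" and e: "bij_betw e (UNIV::'d set) {1..CARD('d)}"
    and ij: "i \<in> {1..CARD('d)}" "j \<in> {1..CARD('d)}" "i \<noteq> j"
    and \<delta>: "0 < \<delta>" "\<delta> < \<mu> i - \<mu> j"
  shows "N (diag_real (\<chi> k. (\<mu>(i := \<mu> i - \<delta>, j := \<mu> j + \<delta>)) (e k))) < N (diag_real (\<chi> k. \<mu> (e k)))"
proof -
  obtain i' j' where i': "e i' = i" and j': "e j' = j"
    using e ij by (metis bij_betw_def imageE)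
  have ei: "e k = i \<longleftrightarrow> k = i'" and ej: "e k = j \<longleftrightarrow> k = j'" for k
    using e i' j' by (auto simp: bij_betw_def inj_on_def)
  define x where "x = (\<chi> k. complex_of_real (\<mu> (e k)))"
  define y where "y = (\<chi> k. x $ Transposition.transpose i' j' k)"
  \<comment> \<open>The weight of the vector that is not transposed, chosen so that the amount moved
    is \<open>\<delta>\<close>.\<close>
  define t where "t = 1 - \<delta> / (\<mu> i - \<mu> j)"
  have t: "0 < t" "t < 1" using \<delta> by (auto simp: t_def)
  have gap: "(1 - t) * (\<mu> i - \<mu> j) = \<delta>" using \<delta> by (simp add: t_def)
  have ui: "unitarily_invariant_norm N" and sc: "strictly_convex_vec_norm (\<lambda>x. N (diag x))"
    using N by (auto simp: strictly_convex_ui_norm_def)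
  obtain P where P: "unitary P" "diag y = P ** diag x ** adj P"
    unfolding y_def using diag_permute[of "Transposition.transpose i' j'" x] by auto
  have Ny: "N (diag x) = N (diag y)" using unitarily_invariant_norm_conj[OF ui P(1)] P(2) by simp
  have "x $ i' \<noteq> y $ i'" using \<delta> i' j' by (simp add: x_def y_def)
  then have "x \<noteq> y" by auto
  then have "N (diag (t *\<^sub>R x + (1 - t) *\<^sub>R y)) < N (diag x)"
    using strictly_convex_vec_norm_combination[OF sc Ny _ t] by simp
  moreover have "t *\<^sub>R x + (1 - t) *\<^sub>R y
      = (\<chi> k. complex_of_real ((\<mu>(i := \<mu> i - \<delta>, j := \<mu> j + \<delta>)) (e k)))"
  proof -
    have mix: "t * \<mu> i + (1 - t) * \<mu> j = \<mu> i - \<delta>" "t * \<mu> j + (1 - t) * \<mu> i = \<mu> j + \<delta>"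
      using gap by (simp_all add: algebra_simps)
    have comb: "t *\<^sub>R complex_of_real a + (1 - t) *\<^sub>R complex_of_real c
        = complex_of_real (t * a + (1 - t) * c)" for a c
      by (simp add: scaleR_conv_of_real)
    have xy: "x $ i' = \<mu> i" "y $ i' = \<mu> j" "x $ j' = \<mu> j" "y $ j' = \<mu> i"
      using i' j' by (simp_all add: x_def y_def)
    have other: "y $ k = x $ k" if "k \<noteq> i'" "k \<noteq> j'" for k
      using that by (simp add: y_def Transposition.transpose_def)
    have "t *\<^sub>R x $ k + (1 - t) *\<^sub>R y $ k = complex_of_real ((\<mu>(i := \<mu> i - \<delta>, j := \<mu> j + \<delta>)) (e k))" for k
    proof -
      consider "k = i'" | "k = j'" | "k \<noteq> i'" "k \<noteq> j'" by blast
      then show ?thesis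
      proof cases
        case 1
        then show ?thesis using ij(3) i' by (simp only: xy comb mix) simp
      next
        case 2
        then show ?thesis using j' by (simp only: xy comb mix) simp
      next
        case 3
        then show ?thesis using ei[of k] ej[of k]
          by (simp add: other x_def flip: scaleR_add_left)
      qed
    qed
    then show ?thesis by (simp add: vec_eq_iff)
  qed
  ultimately show ?thesis by (simp add: diag_real_def x_def)
qed

lemma norm_majorization:
  fixes N :: "complex^'d^'d \<Rightarrow> real"
  assumes N: "strictly_convex_ui_norm N" and e: "bij_betw e (UNIV::'d set) {1..CARD('d)}"
    and b0: "antimono_on {1..CARD('d)} b0" and b: "antimono_on {1..CARD('d)} b"
    and excess: "\<And>t. excess CARD('d) b0 t \<le> excess CARD('d) b t"
    and sum: "sum b0 {1..CARD('d)} = sum b {1..CARD('d)}"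
  shows "N (diag_real (\<chi> k. b0 (e k))) \<le> N (diag_real (\<chi> k. b (e k)))"
    and "\<exists>i\<in>{1..CARD('d)}. b0 i \<noteq> b i \<Longrightarrow>
      N (diag_real (\<chi> k. b0 (e k))) < N (diag_real (\<chi> k. b (e k)))"
proof -
  define n where "n \<mu> = N (diag_real (\<chi> k. \<mu> (e k)))" for \<mu>
  \<comment> \<open>Every transfer lowers \<open>n\<close> strictly, so a vector reached from
    \<open>b\<close> either agrees with \<open>b\<close> or has smaller norm.\<close>
  define Q where "Q \<mu> \<longleftrightarrow> n \<mu> \<le> n b \<and> ((\<exists>i\<in>{1..CARD('d)}. \<mu> i \<noteq> b i) \<longrightarrow> n \<mu> < n b)" for \<mu>
  have "\<exists>\<mu>'. Q \<mu>' \<and> (\<forall>i\<in>{1..CARD('d)}. \<mu>' i = b0 i)"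
  proof (rule transfer_chain[where Q = Q and L = "CARD('d)" and \<mu> = b, OF _ b0 _ _ sum])
    fix \<mu> i j \<delta>
    assume "Q \<mu>" and ij: "i \<in> {1..CARD('d)}" "j \<in> {1..CARD('d)}" "i \<noteq> j" "0 < \<delta>" "\<delta> < \<mu> i - \<mu> j"
    then have "n \<mu> \<le> n b" by (simp add: Q_def)
    moreover have "n (\<mu>(i := \<mu> i - \<delta>, j := \<mu> j + \<delta>)) < n \<mu>"
      unfolding n_def by (rule norm_strict_transfer[OF N e ij])
    ultimately show "Q (\<mu>(i := \<mu> i - \<delta>, j := \<mu> j + \<delta>))" by (simp add: Q_def)
  next
    show "Q b" by (simp add: Q_def)
  next
    fix k assume "k \<le> CARD('d)"
    then show "sum b0 {1..k} \<le> sum b {1..k}"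
      by (rule partial_sums_le_of_excess_le[OF b excess])
  qed
  then obtain \<mu>' where \<mu>': "Q \<mu>'" "\<forall>i\<in>{1..CARD('d)}. \<mu>' i = b0 i" by blast
  have "\<mu>' (e k) = b0 (e k)" for k using \<mu>'(2) e by (auto simp: bij_betw_def)
  then have "n \<mu>' = n b0" by (simp add: n_def)
  then show "N (diag_real (\<chi> k. b0 (e k))) \<le> N (diag_real (\<chi> k. b (e k)))"
    "\<exists>i\<in>{1..CARD('d)}. b0 i \<noteq> b i \<Longrightarrow> N (diag_real (\<chi> k. b0 (e k))) < N (diag_real (\<chi> k. b (e k)))"
    using \<mu>' by (auto simp: Q_def n_def)
qed

text \<open>Minimising over operators instead of families gives the two approximation problems a
  common form, since both see a family only through its frame operator.\<close>

definition minimizers :: "(complex^'d^'d \<Rightarrow> real) \<Rightarrow> complex^'d^'d \<Rightarrow> (complex^'d^'d) set \<Rightarrow> (complex^'d^'d) set"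
  where "minimizers N A \<S> = {S \<in> \<S>. \<forall>S'\<in>\<S>. N (A - S) \<le> N (A - S')}"

text \<open>The minimisers are described by the sorted spectrum of the difference alone, so they do not
  depend on the norm.\<close>

theorem minimizers_frame_ops:
  fixes A :: "complex^'d^'d"
  assumes herm: "adj A = A"
    and w: "antimono_on {1..K} w" "\<forall>i\<in>{1..K}. 0 \<le> w i"
  obtains M where "M \<noteq> {}"
    "\<And>N. strictly_convex_ui_norm N \<Longrightarrow> minimizers N A (frame_op K ` vec_families K w) = M"
proof -
  obtain G0 where G0: "G0 \<in> vec_families K w" and major: "\<And>G b0 u0 b u t. G \<in> vec_families K w \<Longrightarrow>
      eigensystem (A - frame_op K G0) b0 u0 \<Longrightarrow> eigensystem (A - frame_op K G) b u \<Longrightarrow>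
      excess CARD('d) b0 t \<le> excess CARD('d) b t \<and> sum b0 {1..CARD('d)} = sum b {1..CARD('d)}"
    using majorization_optimal_family[OF assms] by blast
  have hermD: "adj (A - frame_op K G) = A - frame_op K G" for G
    using herm by (simp add: adj_diff adj_frame_op)
  obtain b0 u0 where es0: "eigensystem (A - frame_op K G0) b0 u0" and b0: "antimono_on {1..CARD('d)} b0"
    using hermitian_eigensystem[OF hermD] .
  obtain e where e: "bij_betw e (UNIV::'d set) {1..CARD('d)}" by (rule bij_betw_UNIV_nat)
  define M where "M = {S \<in> frame_op K ` vec_families K w. \<exists>b u. eigensystem (A - S) b u \<and>
    antimono_on {1..CARD('d)} b \<and> (\<forall>i\<in>{1..CARD('d)}. b i = b0 i)}"
  have G0M: "frame_op K G0 \<in> M" using G0 es0 b0 by (auto simp: M_def)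
  moreover have "minimizers N A (frame_op K ` vec_families K w) = M"
    if N: "strictly_convex_ui_norm N" for N
  proof -
    have ui: "unitarily_invariant_norm N" using N by (simp add: strictly_convex_ui_norm_def)
    have Neig: "N D = N (diag_real (\<chi> k. b (e k)))" if "eigensystem D b u" for D b u
      using eigensystem_diagonalization[OF that e] unitarily_invariant_norm_conj[OF ui] by metis
    have least: "N (A - frame_op K G0) \<le> N (A - frame_op K G)"
      and strict: "frame_op K G \<notin> M \<Longrightarrow> N (A - frame_op K G0) < N (A - frame_op K G)"
      if G: "G \<in> vec_families K w" for G
    proof -
      obtain b u where es: "eigensystem (A - frame_op K G) b u" and b: "antimono_on {1..CARD('d)} b"
        using hermitian_eigensystem[OF hermD] .
      note maj = major[OF G es0 es]
      show "N (A - frame_op K G0) \<le> N (A - frame_op K G)"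
        unfolding Neig[OF es0] Neig[OF es]
        by (rule norm_majorization(1)[OF N e b0 b]) (use maj in auto)
      assume "frame_op K G \<notin> M"
      have "\<exists>i\<in>{1..CARD('d)}. b0 i \<noteq> b i"
      proof (rule ccontr)
        assume "\<not> ?thesis"
        then have "\<forall>i\<in>{1..CARD('d)}. b i = b0 i" by auto
        then have "frame_op K G \<in> M" using G es b unfolding M_def by blast
        then show False using \<open>frame_op K G \<notin> M\<close> by simp
      qed
      then show "N (A - frame_op K G0) < N (A - frame_op K G)"
        unfolding Neig[OF es0] Neig[OF es]
        by (intro norm_majorization(2)[OF N e b0 b]) (use maj in auto)
    qed
    have eq: "N (A - S) = N (A - frame_op K G0)" if S: "S \<in> M" for S
    proof -
      obtain b u where es: "eigensystem (A - S) b u" and b: "\<forall>i\<in>{1..CARD('d)}. b i = b0 i"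
        using S by (auto simp: M_def)
      have "b (e k) = b0 (e k)" for k using b e by (auto simp: bij_betw_def)
      then show ?thesis unfolding Neig[OF es0] Neig[OF es] by simp
    qed
    show ?thesis
    proof (intro subset_antisym subsetI)
      fix S assume "S \<in> minimizers N A (frame_op K ` vec_families K w)"
      then obtain G where G: "S = frame_op K G" "G \<in> vec_families K w"
        and "N (A - S) \<le> N (A - frame_op K G0)" using G0 by (auto simp: minimizers_def)
      then show "S \<in> M" using strict[OF G(2)] by force
    next
      fix S assume S: "S \<in> M"
      then show "S \<in> minimizers N A (frame_op K ` vec_families K w)"
        using eq[OF S] least by (auto simp: minimizers_def M_def)
    qed
  qed
  ultimately show ?thesis using that[of M] by blast
qed

section \<open>Generalised frames\<close>

text \<open>Rows are conjugated because a coordinate of \<open>T *v x\<close> is the inner product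
  of \<open>x\<close> with the conjugated row.\<close>

lemma adj_mult_self_rows:
  fixes T :: "complex^'d^'n"
  shows "adj T ** T = (\<Sum>r\<in>UNIV. rank_one (\<chi> c. cnj (T $ r $ c)))"
  by (simp add: vec_eq_iff matrix_matrix_mult_def adj_def map_matrix_def transpose_def rank_one_def)

lemma frobenius_sq_rows:
  fixes T :: "complex^'d^'n"
  shows "frobenius_sq T = (\<Sum>r\<in>UNIV. (norm (\<chi> c. cnj (T $ r $ c)))\<^sup>2)"
proof -
  have "frobenius_sq T = (\<Sum>c\<in>UNIV. \<Sum>r\<in>UNIV. (cmod (T $ r $ c))\<^sup>2)"
    by (simp add: frobenius_sq_def trace_def matrix_matrix_mult_def adj_def map_matrix_def
        transpose_def cmod_power2 flip: power2_eq_square)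
  also have "\<dots> = (\<Sum>r\<in>UNIV. \<Sum>c\<in>UNIV. (cmod (T $ r $ c))\<^sup>2)" by (rule sum.swap)
  finally show ?thesis by (simp add: norm_vec_def L2_set_def sum_nonneg)
qed

lemma g_bessel_always: "g_bessel m (F :: nat \<Rightarrow> complex^'d^'n)"
proof -
  have "\<exists>B>0. \<forall>x. norm (F i *v x) \<le> B * norm x" for i
  proof -
    have "linear (\<lambda>x. F i *v x)"
      by (rule linearI, rule matrix_vector_right_distrib)
         (simp add: vec_eq_iff matrix_vector_mult_def scaleR_sum_right)
    then show ?thesis
      using bounded_linear.pos_bounded[of "\<lambda>x. F i *v x"] linear_conv_bounded_linear
      by (auto simp: mult.commute)
  qed
  then obtain B where B: "\<And>i. B i > 0" "\<And>i x. norm (F i *v x) \<le> B i * norm x" by metis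
  \<comment> \<open>The summand 1 keeps the bound positive when \<open>m = 0\<close>.\<close>
  define b where "b = 1 + (\<Sum>i\<in>{1..m}. (B i)\<^sup>2)"
  have "(\<Sum>i\<in>{1..m}. (norm (F i *v x))\<^sup>2) \<le> b * (norm x)\<^sup>2" for x
  proof -
    have "(\<Sum>i\<in>{1..m}. (norm (F i *v x))\<^sup>2) \<le> (\<Sum>i\<in>{1..m}. (B i * norm x)\<^sup>2)"
      by (intro sum_mono power_mono B) auto
    also have "\<dots> \<le> b * (norm x)\<^sup>2"
      by (simp add: b_def power_mult_distrib sum_distrib_right distrib_right)
    finally show ?thesis .
  qed
  moreover have "b > 0" by (simp add: b_def add_pos_nonneg sum_nonneg)
  ultimately show ?thesis by (auto simp: g_bessel_def)
qed

text \<open>Rotating pairs of rows fixes \<open>adj T ** T\<close> and averages the squared row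
  norms, whose sum is \<open>frobenius_sq T\<close>.\<close>

lemma equal_norm_rows:
  fixes T :: "complex^'d^'n"
  obtains h where "\<And>r. (norm (h r))\<^sup>2 = frobenius_sq T / real CARD('n)"
    "(\<Sum>r\<in>(UNIV::'n set). rank_one (h r)) = adj T ** T"
proof -
  have "realizable UNIV (adj T ** T) (\<lambda>r. (norm (\<chi> c. cnj (T $ r $ c)))\<^sup>2)"
    unfolding realizable_def adj_mult_self_rows by (rule exI[of _ "\<lambda>r. \<chi> c. cnj (T $ r $ c)"]) simp
  then have "\<exists>\<mu>. realizable (UNIV::'n set) (adj T ** T) \<mu> \<and>
      (\<forall>r\<in>UNIV. \<mu> r = frobenius_sq T / real CARD('n))"
    by (intro transfer_chain_constant[where Q = "realizable UNIV (adj T ** T)"])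
       (auto simp: frobenius_sq_rows intro: realizable_transfer)
  then obtain h where "\<forall>r. (norm (h r))\<^sup>2 = frobenius_sq T / real CARD('n)"
    "(\<Sum>r\<in>(UNIV::'n set). rank_one (h r)) = adj T ** T"
    by (auto simp: realizable_def)
  then show ?thesis using that[of h] by simp
qed

text \<open>Families start at index 1, so it is \<open>k - 1\<close> that splits into block number
  and place within the block, as in \<open>split_weights\<close>.\<close>

lemma frame_op_blocks:
  fixes h :: "nat \<Rightarrow> 'n::finite \<Rightarrow> complex^'d"
  assumes e: "bij_betw e {..<CARD('n)} (UNIV::'n set)"
    and G: "\<And>i q. i < m \<Longrightarrow> q < CARD('n) \<Longrightarrow> G (Suc (i * CARD('n) + q)) = h (Suc i) (e q)"
  shows "frame_op (m * CARD('n)) G = (\<Sum>i\<in>{1..m}. \<Sum>r\<in>UNIV. rank_one (h i r))"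
proof -
  have "frame_op (m * CARD('n)) G = (\<Sum>k<m * CARD('n). rank_one (G (Suc k)))"
    unfolding frame_op_def One_nat_def by (rule sum.atLeast1_atMost_eq)
  also have "\<dots> = (\<Sum>i<m. \<Sum>k\<in>{i * CARD('n)..<i * CARD('n) + CARD('n)}. rank_one (G (Suc k)))"
    by (rule sum.nat_group[symmetric])
  also have "\<dots> = (\<Sum>i<m. \<Sum>q<CARD('n). rank_one (G (Suc (i * CARD('n) + q))))"
    by (simp add: sum.atLeastLessThan_shift_0 atLeast0LessThan)
  also have "\<dots> = (\<Sum>i<m. \<Sum>q<CARD('n). rank_one (h (Suc i) (e q)))"
    by (simp add: G)
  also have "\<dots> = (\<Sum>i<m. \<Sum>r\<in>UNIV. rank_one (h (Suc i) r))"
    by (intro sum.cong refl sum.reindex_bij_betw[OF e])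
  also have "\<dots> = (\<Sum>i\<in>{1..m}. \<Sum>r\<in>UNIV. rank_one (h i r))"
    unfolding One_nat_def by (rule sum.atLeast1_atMost_eq[symmetric])
  finally show ?thesis .
qed

text \<open>One inclusion equalises the rows of each operator. For the other, each block of
  consecutive vectors is conjugated and stacked as the rows of one operator; its equal weights add
  up to \<open>\<alpha> i\<close>.\<close>

theorem g_frame_ops_eq_frame_ops:
  "g_frame_op m ` (Lambda_set m \<alpha> :: (nat \<Rightarrow> complex^'d^'n) set)
    = frame_op (m * CARD('n)) ` vec_families (m * CARD('n)) (split_weights CARD('n) \<alpha>)"
proof (intro subset_antisym subsetI)
  let ?n = "CARD('n)"
  obtain e where e: "bij_betw e {..<?n} (UNIV::'n set)"
    using ex_bij_betw_nat_finite[of "UNIV::'n set"] by (auto simp: atLeast0LessThan)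
  {
    fix S assume "S \<in> g_frame_op m ` (Lambda_set m \<alpha> :: (nat \<Rightarrow> complex^'d^'n) set)"
    then obtain F :: "nat \<Rightarrow> complex^'d^'n" where F: "\<forall>i\<in>{1..m}. frobenius_sq (F i) = \<alpha> i"
      and S: "S = g_frame_op m F" by (auto simp: Lambda_set_def)
    have "\<exists>h :: 'n \<Rightarrow> complex^'d. (\<forall>r. (norm (h r))\<^sup>2 = frobenius_sq (F i) / real ?n) \<and>
        (\<Sum>r\<in>UNIV. rank_one (h r)) = adj (F i) ** F i" for i
      using equal_norm_rows[of "F i"] by metis
    then obtain h :: "nat \<Rightarrow> 'n \<Rightarrow> complex^'d"
      where h: "\<And>i r. (norm (h i r))\<^sup>2 = frobenius_sq (F i) / real ?n"
      "\<And>i. (\<Sum>r\<in>UNIV. rank_one (h i r)) = adj (F i) ** F i" by metis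
    define G where "G k = h ((k - 1) div ?n + 1) (e ((k - 1) mod ?n))" for k
    have "frame_op (m * ?n) G = (\<Sum>i\<in>{1..m}. \<Sum>r\<in>UNIV. rank_one (h i r))"
      by (rule frame_op_blocks[OF e]) (simp add: G_def)
    then have "S = frame_op (m * ?n) G" by (simp add: S g_frame_op_def h(2))
    moreover have "G \<in> vec_families (m * ?n) (split_weights ?n \<alpha>)"
    proof -
      have "(k - 1) div ?n + 1 \<in> {1..m}" if "k \<in> {1..m * ?n}" for k
        using that by (auto simp: Suc_le_eq less_mult_imp_div_less)
      then show ?thesis using F by (simp add: vec_families_def G_def h(1) split_weights_def)
    qed
    ultimately show "S \<in> frame_op (m * ?n) ` vec_families (m * ?n) (split_weights ?n \<alpha>)" by blast
  next
    fix S :: "complex^'d^'d"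
    assume "S \<in> frame_op (m * ?n) ` vec_families (m * ?n) (split_weights ?n \<alpha>)"
    then obtain G where G: "\<forall>k\<in>{1..m * ?n}. (norm (G k))\<^sup>2 = \<alpha> ((k - 1) div ?n + 1) / real ?n"
      and S: "S = frame_op (m * ?n) G"
      unfolding vec_families_def split_weights_def by blast
    define h where "h i r = G (Suc ((i - 1) * ?n + the_inv_into {..<?n} e r))" for i r
    define F :: "nat \<Rightarrow> complex^'d^'n" where "F i = (\<chi> r c. cnj (h i r $ c))" for i
    have rows: "(\<chi> c. cnj (F i $ r $ c)) = h i r" for i r by (simp add: F_def vec_eq_iff)
    have inv: "the_inv_into {..<?n} e r < ?n" for r
      using the_inv_into_into[of e "{..<?n}" r "{..<?n}"] e by (auto simp: bij_betw_def)
    have "frame_op (m * ?n) G = (\<Sum>i\<in>{1..m}. \<Sum>r\<in>UNIV. rank_one (h i r))"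
    proof (rule frame_op_blocks[OF e])
      fix i q assume "q < ?n"
      then show "G (Suc (i * ?n + q)) = h (Suc i) (e q)"
        using e by (simp add: h_def bij_betw_def the_inv_into_f_f)
    qed
    then have "S = g_frame_op m F" by (simp add: S g_frame_op_def adj_mult_self_rows rows)
    moreover have "frobenius_sq (F i) = \<alpha> i" if i: "i \<in> {1..m}" for i
    proof -
      have "(norm (h i r))\<^sup>2 = \<alpha> i / real ?n" for r
      proof -
        have "(i - 1) * ?n + the_inv_into {..<?n} e r < (i - 1) * ?n + ?n" using inv by simp
        also have "\<dots> = i * ?n" using i by (cases i) auto
        also have "\<dots> \<le> m * ?n" using i by simp
        finally have "Suc ((i - 1) * ?n + the_inv_into {..<?n} e r) \<in> {1..m * ?n}" by simp
        then have "(norm (h i r))\<^sup>2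
            = \<alpha> (((i - 1) * ?n + the_inv_into {..<?n} e r) div ?n + 1) / real ?n"
          using bspec[OF G] by (simp add: h_def)
        then show ?thesis using inv[of r] i by simp
      qed
      then show ?thesis by (simp add: frobenius_sq_rows rows)
    qed
    ultimately show "S \<in> g_frame_op m ` (Lambda_set m \<alpha> :: (nat \<Rightarrow> complex^'d^'n) set)"
      by (auto simp: Lambda_set_def g_bessel_always)
  }
qed

lemma best_g_image:
  "g_frame_op m ` (best_g N A m \<alpha> :: (nat \<Rightarrow> complex^'d^'n) set)
    = minimizers N A (g_frame_op m ` (Lambda_set m \<alpha> :: (nat \<Rightarrow> complex^'d^'n) set))"
  by (auto simp: best_g_def minimizers_def)

text \<open>The best families form the full preimage of the best operators, which is what carries
  independence of the norm from operators back to families.\<close>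

lemma best_g_eq_vimage:
  "(best_g N A m \<alpha> :: (nat \<Rightarrow> complex^'d^'n) set)
    = {F \<in> Lambda_set m \<alpha>. g_frame_op m F
        \<in> minimizers N A (g_frame_op m ` (Lambda_set m \<alpha> :: (nat \<Rightarrow> complex^'d^'n) set))}"
  by (auto simp: best_g_def minimizers_def)

lemma best_classical_image:
  "frame_op K ` best_classical N A K w = minimizers N A (frame_op K ` vec_families K w)"
  by (auto simp: best_classical_def minimizers_def)

section \<open>Reduction to the spectrum by unitary conjugation\<close>

lemma frame_ops_unitary_conj:
  assumes "unitary V" "S \<in> frame_op K ` vec_families K w"
  shows "V ** S ** adj V \<in> frame_op K ` vec_families K w"
  using assms vec_families_unitary_mult[OF assms(1)]
  by (auto simp flip: frame_op_unitary_mult)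

lemma frame_ops_unitary_conj_adj:
  assumes "unitary V" "S \<in> frame_op K ` vec_families K w"
  shows "adj V ** S ** V \<in> frame_op K ` vec_families K w"
  using frame_ops_unitary_conj[OF unitary_adj[OF assms(1)] assms(2)] by simp

lemma norm_unitary_conj_diff:
  assumes "unitarily_invariant_norm N" "unitary V" "A = V ** D ** adj V"
  shows "N (A - V ** S ** adj V) = N (D - S)"
  using unitarily_invariant_norm_conj[OF assms(1,2), of "D - S"] assms(3)
  by (simp add: unitary_conj_diff)

text \<open>Conjugation by \<open>V\<close> permutes the frame operators, as rotated vectors keep
  their norms, and it preserves the distances. The two sets of values therefore coincide.\<close>

lemma INF_frame_ops_unitary_conj:
  fixes A :: "complex^'d^'d"
  assumes N: "unitarily_invariant_norm N" and V: "unitary V" and A: "A = V ** D ** adj V"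
  shows "(INF S\<in>frame_op K ` vec_families K w. N (A - S))
    = (INF S\<in>frame_op K ` vec_families K w. N (D - S))"
proof -
  let ?S = "frame_op K ` vec_families K w :: (complex^'d^'d) set"
  have "(\<lambda>S. N (A - S)) ` ?S = (\<lambda>S. N (D - S)) ` ?S"
  proof (intro subset_antisym image_subsetI)
    fix S assume S: "S \<in> ?S"
    have "N (A - S) = N (D - adj V ** S ** V)"
      using norm_unitary_conj_diff[OF N V A, of "adj V ** S ** V"] unitary_conj_cancel[OF V] by simp
    then show "N (A - S) \<in> (\<lambda>S. N (D - S)) ` ?S" using frame_ops_unitary_conj_adj[OF V S] by simp
    show "N (D - S) \<in> (\<lambda>S. N (A - S)) ` ?S"
      using norm_unitary_conj_diff[OF N V A, of S] frame_ops_unitary_conj[OF V S]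
      by (intro image_eqI[of _ _ "V ** S ** adj V"]) simp_all
  qed
  then show ?thesis by simp
qed

lemma minimizers_unitary_conj:
  fixes A :: "complex^'d^'d"
  assumes N: "unitarily_invariant_norm N" and V: "unitary V" and A: "A = V ** D ** adj V"
  shows "V ** S ** adj V \<in> minimizers N A (frame_op K ` vec_families K w)
    \<longleftrightarrow> S \<in> minimizers N D (frame_op K ` vec_families K w)"
proof -
  let ?S = "frame_op K ` vec_families K w :: (complex^'d^'d) set"
  have cancel: "adj V ** (V ** S ** adj V) ** V = S" for S
    using unitary_conj_cancel[OF unitary_adj[OF V]] by simp
  have mem: "V ** S ** adj V \<in> ?S \<longleftrightarrow> S \<in> ?S" for S
    using frame_ops_unitary_conj[OF V] frame_ops_unitary_conj_adj[OF V] cancel by metis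
  have "(\<forall>S'\<in>?S. N (D - S) \<le> N (A - S')) \<longleftrightarrow> (\<forall>S'\<in>?S. N (D - S) \<le> N (D - S'))"
    using norm_unitary_conj_diff[OF N V A] unitary_conj_cancel[OF V] mem by metis
  then show ?thesis
    by (simp add: minimizers_def mem norm_unitary_conj_diff[OF N V A])
qed

text \<open>Any diagonalising \<open>V\<close> sends minimisers for \<open>diag_real l\<close> to
  minimisers for \<open>A\<close>, and a single such \<open>V\<close> already reaches all of
  them.\<close>

theorem minimizers_via_spectrum:
  assumes herm: "adj A = A" and l: "spectrum_list A l" and N: "unitarily_invariant_norm N"
  shows "minimizers N A (frame_op K ` vec_families K w)
    = {V ** frame_op K G ** adj V | V G. unitary V \<and> A = V ** diag_real l ** adj V
        \<and> G \<in> best_classical N (diag_real l) K w}" (is "?L = ?R")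
proof (intro subset_antisym subsetI)
  fix S assume S: "S \<in> ?L"
  obtain V where V: "unitary V" "A = V ** diag_real l ** adj V"
    using hermitian_spectrum_list_diagonalization[OF herm l] .
  have "adj V ** S ** V \<in> minimizers N (diag_real l) (frame_op K ` vec_families K w)"
    using S minimizers_unitary_conj[OF N V, of "adj V ** S ** V"] unitary_conj_cancel[OF V(1)]
    by simp
  then obtain G where "G \<in> best_classical N (diag_real l) K w" "adj V ** S ** V = frame_op K G"
    unfolding best_classical_image[symmetric] by blast
  then show "S \<in> ?R" using V unitary_conj_cancel[OF V(1), of S] by force
next
  fix S assume "S \<in> ?R"
  then obtain V G where V: "unitary V" "A = V ** diag_real l ** adj V"
    and S: "S = V ** frame_op K G ** adj V" and G: "G \<in> best_classical N (diag_real l) K w"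
    by blast
  have "frame_op K G \<in> minimizers N (diag_real l) (frame_op K ` vec_families K w)"
    using G unfolding best_classical_image[symmetric] by blast
  then show "S \<in> ?L" unfolding S using minimizers_unitary_conj[OF N V] by blast
qed

lemma split_weights_antimono:
  assumes "antimono_on {1..m} \<alpha>" "0 < n"
  shows "antimono_on {1..m * n} (split_weights n \<alpha>)"
proof (rule monotone_onI)
  fix x y assume xy: "x \<in> {1..m * n}" "y \<in> {1..m * n}" "x \<le> y"
  have "(x - 1) div n \<le> (y - 1) div n" using xy by (intro div_le_mono) simp
  moreover have "(y - 1) div n < m" using xy by (intro less_mult_imp_div_less) auto
  ultimately have "\<alpha> ((y - 1) div n + 1) \<le> \<alpha> ((x - 1) div n + 1)"
    by (intro monotone_onD[OF assms(1)]) auto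
  then show "split_weights n \<alpha> y \<le> split_weights n \<alpha> x"
    by (simp add: split_weights_def divide_right_mono)
qed

lemma split_weights_nonneg:
  assumes "\<forall>j\<in>{1..m}. 0 \<le> \<alpha> j"
  shows "\<forall>i\<in>{1..m * n}. 0 \<le> split_weights n \<alpha> i"
proof
  fix i assume "i \<in> {1..m * n}"
  then have "(i - 1) div n < m" by (intro less_mult_imp_div_less) auto
  then show "0 \<le> split_weights n \<alpha> i" using assms by (simp add: split_weights_def)
qed

theorem theorem5p4:
  fixes m :: nat
    and \<alpha> :: "nat \<Rightarrow> real"
    and N :: "complex^'d^'d \<Rightarrow> real"
    and A :: "complex^'d^'d"
    and \<Lambda> :: "(nat \<Rightarrow> complex^'d^'n) set"
    and K :: nat
    and w :: "nat \<Rightarrow> real"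
  defines "\<Lambda> \<equiv> Lambda_set m \<alpha>"
    and "K \<equiv> m * CARD('n)"
    and "w \<equiv> split_weights CARD('n) \<alpha>"
  assumes "\<forall>j\<in>{1..m}. 0 \<le> \<alpha> j"
    and "antimono_on {1..m} \<alpha>"
    and "strictly_convex_ui_norm N"
    and "psd A"
  shows
    "(\<exists>Fop\<in>\<Lambda>. \<forall>F\<in>\<Lambda>. N (A - g_frame_op m Fop) \<le> N (A - g_frame_op m F))
     \<and> (INF F\<in>\<Lambda>. N (A - g_frame_op m F)) = (INF G\<in>vec_families K w. N (A - frame_op K G))
     \<and> g_frame_op m ` (best_g N A m \<alpha> :: (nat \<Rightarrow> complex^'d^'n) set)
         = frame_op K ` best_classical N A K w
     \<and> (\<exists>l. spectrum_list A l)
     \<and> (\<forall>l. spectrum_list A l \<longrightarrow>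
          (INF F\<in>\<Lambda>. N (A - g_frame_op m F))
            = (INF G\<in>vec_families K w. N (diag_real l - frame_op K G))
          \<and> g_frame_op m ` (best_g N A m \<alpha> :: (nat \<Rightarrow> complex^'d^'n) set)
            = {V ** frame_op K G ** adj V | V G.
                 unitary V \<and> A = V ** diag_real l ** adj V
                 \<and> G \<in> best_classical N (diag_real l) K w})
     \<and> (\<forall>N'. strictly_convex_ui_norm N' \<longrightarrow>
          (best_g N' A m \<alpha> :: (nat \<Rightarrow> complex^'d^'n) set) = best_g N A m \<alpha>)"
proof -
  let ?S = "frame_op K ` (vec_families K w :: (nat \<Rightarrow> complex^'d) set)"
  have herm: "adj A = A" using assms by (simp add: psd_def)
  have ui: "unitarily_invariant_norm N" using assms by (simp add: strictly_convex_ui_norm_def)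
  have ops: "g_frame_op m ` (Lambda_set m \<alpha> :: (nat \<Rightarrow> complex^'d^'n) set) = ?S"
    unfolding K_def w_def by (rule g_frame_ops_eq_frame_ops)
  have w: "antimono_on {1..K} w" "\<forall>i\<in>{1..K}. 0 \<le> w i"
    unfolding K_def w_def using split_weights_antimono[OF assms(5)] split_weights_nonneg[OF assms(4)]
    by simp_all
  obtain M where M: "M \<noteq> {}" "\<And>N. strictly_convex_ui_norm N \<Longrightarrow> minimizers N A ?S = M"
    using minimizers_frame_ops[OF herm w] by blast
  have best: "g_frame_op m ` (best_g N A m \<alpha> :: (nat \<Rightarrow> complex^'d^'n) set) = minimizers N A ?S" for N
    unfolding best_g_image ops ..
  have inf_g: "(INF F\<in>\<Lambda>. N (A - g_frame_op m F)) = (INF S\<in>?S. N (A - S))"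
    unfolding \<Lambda>_def ops[symmetric] by (simp add: image_image)
  have inf_c: "(INF G\<in>vec_families K w. N (D - frame_op K G)) = (INF S\<in>?S. N (D - S))" for D
    by (simp add: image_image)
  have "minimizers N A ?S \<noteq> {}" using M assms by simp
  then have exists: "\<exists>Fop\<in>\<Lambda>. \<forall>F\<in>\<Lambda>. N (A - g_frame_op m Fop) \<le> N (A - g_frame_op m F)"
    unfolding \<Lambda>_def ops[symmetric] by (auto simp: minimizers_def)
  have spectral: "(INF F\<in>\<Lambda>. N (A - g_frame_op m F))
            = (INF G\<in>vec_families K w. N (diag_real l - frame_op K G))
          \<and> g_frame_op m ` (best_g N A m \<alpha> :: (nat \<Rightarrow> complex^'d^'n) set)
            = {V ** frame_op K G ** adj V | V G.
                 unitary V \<and> A = V ** diag_real l ** adj V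
                 \<and> G \<in> best_classical N (diag_real l) K w}"
    if l: "spectrum_list A l" for l
  proof -
    obtain V where V: "unitary V" "A = V ** diag_real l ** adj V"
      using hermitian_spectrum_list_diagonalization[OF herm l] .
    show ?thesis
      unfolding inf_g inf_c best
      using INF_frame_ops_unitary_conj[OF ui V] minimizers_via_spectrum[OF herm l ui] by blast
  qed
  have indep: "(best_g N' A m \<alpha> :: (nat \<Rightarrow> complex^'d^'n) set) = best_g N A m \<alpha>"
    if "strictly_convex_ui_norm N'" for N'
    unfolding best_g_eq_vimage[of N'] best_g_eq_vimage[of N] ops using M(2) that assms by simp
  show ?thesis
    using exists inf_g inf_c[of A] best[of N] best_classical_image[of K N A w]
      hermitian_spectrum_list_exists[OF herm] spectral indep
    by auto
qed

end
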